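(* Let $n$ be a positive integer, $K$ a field with $\mathrm{char}(K)=0$ or $\mathrm{char}(K)>n$, and let $A=\bigoplus_{d\ge 0}A_d$ be a commutative graded $K$-algebra with $A_0=K$, whose minimal positive degree (non-zero) homogeneous component has degree $q$. (i) Suppose that $b$ is a non-zero homogeneous element of $A$ of positive degree with $\deg(b)<(n+1)q$. Then $[b]$ is an indecomposable element of the graded algebra $T^n(A)^{S_n}$. (ii) Suppose that $\mathcal{B}$ is a $K$-linearly independent subset of $A$ consisting of homogeneous elements of positive degree strictly less than $(n+1)q$. Then the set $\{[b]\mid b\in\mathcal{B}\}$ is part of a minimal homogeneous $K$-algebra generating system of $T^n(A)^{S_n}$.
   Context: $T^n(A)$ is the $n$th tensor power of $A$ over $K$, on which the symmetric group $S_n$ acts by permuting the tensor factors; $T^n(A)^{S_n}$ is the subalgebra of invariants, graded by the grading induced from $A$ (total degree). For $b\in A$, $$[b]:=b\otimes 1\otimes\cdots\otimes 1+1\otimes b\otimes 1\otimes\cdots\otimes 1+\cdots+1\otimes\cdots\otimes 1\otimes b\in T^n(A)^{S_n}.$$ For a graded algebra $R=\bigoplus_{d\ge0}R_d$ with $R_0=K$ put $R_+:=\bigoplus_{d>0}R_d$. A homogeneous element $r\in R_+$ is called indecomposable if $r\notin (R_+)^2$; that is, $r$ is not contained in the subalgebra generated by lower degree elements. *)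

theory Defs
  imports
    "HOL-Combinatorics.Permutations"
    "HOL-Library.Poly_Mapping"
    "HOL-Algebra.QuotRing"
    "HOL-Algebra.Generated_Rings"
    "HOL-Algebra.Ideal_Product"
begin

section \<open>Commutative graded algebras with degree zero part the base field\<close>

locale connected_graded_algebra = vector_space scale
  for scale :: "'k::field \<Rightarrow> 'a::comm_ring_1 \<Rightarrow> 'a" +
  fixes A :: "nat \<Rightarrow> 'a set"
  assumes scale_mult_left: "scale c x * y = scale c (x * y)"
    and subspace_comp: "subspace (A d)"
    and direct_sum: "\<exists>!f. finite {d. f d \<noteq> 0} \<and> (\<forall>d. f d \<in> A d) \<and> (\<Sum>d | f d \<noteq> 0. f d) = x"
    and comp_mult: "x \<in> A d \<Longrightarrow> y \<in> A e \<Longrightarrow> x * y \<in> A (d + e)"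
    and comp_0: "A 0 = range (\<lambda>c. scale c 1)"

section \<open>The tensor power\<close>

text \<open>
  The tensor power is the quotient of the \<open>K\<close>-vector space with basis the \<open>n\<close>-tuples over the
  algebra by the span of the multilinearity relations.  Tuples are lists of length \<open>n\<close>, and the
  multiplication is induced by the componentwise multiplication of tuples.
\<close>

definition free_smult :: "'k::field \<Rightarrow> ('a list \<Rightarrow>\<^sub>0 'k) \<Rightarrow> ('a list \<Rightarrow>\<^sub>0 'k)"
  where "free_smult c = Poly_Mapping.map ((*) c)"

definition free_mult ::
  "('a::comm_ring_1 list \<Rightarrow>\<^sub>0 'k::field) \<Rightarrow> ('a list \<Rightarrow>\<^sub>0 'k) \<Rightarrow> ('a list \<Rightarrow>\<^sub>0 'k)"
  where "free_mult f g =
    (\<Sum>u\<in>Poly_Mapping.keys f. \<Sum>v\<in>Poly_Mapping.keys g. Poly_Mapping.single (map2 (*) u v) (Poly_Mapping.lookup f u * Poly_Mapping.lookup g v))"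

definition free_algebra :: "nat \<Rightarrow> ('a::comm_ring_1 list \<Rightarrow>\<^sub>0 'k::field) ring"
  where "free_algebra n =
    \<lparr>carrier = {f. \<forall>u\<in>Poly_Mapping.keys f. length u = n}, monoid.mult = free_mult,
     one = Poly_Mapping.single (replicate n 1) 1, zero = 0, add = (+)\<rparr>"

inductive_set multilinear_rels ::
  "('k::field \<Rightarrow> 'a::comm_ring_1 \<Rightarrow> 'a) \<Rightarrow> nat \<Rightarrow> ('a list \<Rightarrow>\<^sub>0 'k) set"
  for scale and n where
    add: "length u = n \<Longrightarrow> i < n \<Longrightarrow>
      Poly_Mapping.single (u[i := x + y]) 1 - Poly_Mapping.single (u[i := x]) 1
        - Poly_Mapping.single (u[i := y]) 1 \<in> multilinear_rels scale n"
  | scale: "length u = n \<Longrightarrow> i < n \<Longrightarrow>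
      Poly_Mapping.single (u[i := scale c x]) 1 - Poly_Mapping.single (u[i := x]) c
        \<in> multilinear_rels scale n"

definition tensor_rel ::
  "('k::field \<Rightarrow> 'a::comm_ring_1 \<Rightarrow> 'a) \<Rightarrow> nat \<Rightarrow> ('a list \<Rightarrow>\<^sub>0 'k) set"
  where "tensor_rel scale n = module.span free_smult (multilinear_rels scale n)"

definition tensor_power ::
  "('k::field \<Rightarrow> 'a::comm_ring_1 \<Rightarrow> 'a) \<Rightarrow> nat \<Rightarrow> ('a list \<Rightarrow>\<^sub>0 'k) set ring"
  where "tensor_power scale n = free_algebra n Quot tensor_rel scale n"

definition tensor_class ::
  "('k::field \<Rightarrow> 'a::comm_ring_1 \<Rightarrow> 'a) \<Rightarrow> nat \<Rightarrow> ('a list \<Rightarrow>\<^sub>0 'k) \<Rightarrow> ('a list \<Rightarrow>\<^sub>0 'k) set"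
  where "tensor_class scale n f = tensor_rel scale n +>\<^bsub>free_algebra n\<^esub> f"

definition pure_tensor ::
  "('k::field \<Rightarrow> 'a::comm_ring_1 \<Rightarrow> 'a) \<Rightarrow> nat \<Rightarrow> 'a list \<Rightarrow> ('a list \<Rightarrow>\<^sub>0 'k) set"
  where "pure_tensor scale n u = tensor_class scale n (Poly_Mapping.single u 1)"

text \<open>The image of the base field under the structure map \<open>c \<mapsto> c \<cdot> 1\<close>.\<close>

definition tensor_scalars ::
  "('k::field \<Rightarrow> 'a::comm_ring_1 \<Rightarrow> 'a) \<Rightarrow> nat \<Rightarrow> ('a list \<Rightarrow>\<^sub>0 'k) set set"
  where "tensor_scalars scale n =
    range (\<lambda>c. tensor_class scale n (Poly_Mapping.single (replicate n 1) c))"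

text \<open>
  The homogeneous component of total degree \<open>d\<close> is the span of the pure tensors of homogeneous
  elements whose degrees add up to \<open>d\<close>.
\<close>

definition tensor_comp ::
  "('k::field \<Rightarrow> 'a::comm_ring_1 \<Rightarrow> 'a) \<Rightarrow> (nat \<Rightarrow> 'a set) \<Rightarrow> nat \<Rightarrow> nat \<Rightarrow> ('a list \<Rightarrow>\<^sub>0 'k) set set"
  where "tensor_comp scale A n d = tensor_class scale n `
    {f. \<forall>u\<in>Poly_Mapping.keys f. \<exists>ds. length u = n \<and> length ds = n \<and> sum_list ds = d \<and> (\<forall>i<n. u ! i \<in> A (ds ! i))}"

section \<open>The symmetric group action and its invariants\<close>

definition free_permute :: "(nat \<Rightarrow> nat) \<Rightarrow> ('a list \<Rightarrow>\<^sub>0 'k::field) \<Rightarrow> ('a list \<Rightarrow>\<^sub>0 'k)"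
  where "free_permute p f = (\<Sum>u\<in>Poly_Mapping.keys f. Poly_Mapping.single (permute_list p u) (Poly_Mapping.lookup f u))"

text \<open>
  The relations are stable under permutations, so the action on a coset is the image of the coset.
\<close>

definition sym_invariants ::
  "('k::field \<Rightarrow> 'a::comm_ring_1 \<Rightarrow> 'a) \<Rightarrow> nat \<Rightarrow> ('a list \<Rightarrow>\<^sub>0 'k) set ring"
  where "sym_invariants scale n = (tensor_power scale n)
    \<lparr>carrier := {X \<in> carrier (tensor_power scale n). \<forall>p. p permutes {..<n} \<longrightarrow> free_permute p ` X = X}\<rparr>"

definition sym_comp ::
  "('k::field \<Rightarrow> 'a::comm_ring_1 \<Rightarrow> 'a) \<Rightarrow> (nat \<Rightarrow> 'a set) \<Rightarrow> nat \<Rightarrow> nat \<Rightarrow> ('a list \<Rightarrow>\<^sub>0 'k) set set"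
  where "sym_comp scale A n d = tensor_comp scale A n d \<inter> carrier (sym_invariants scale n)"

definition bracket ::
  "('k::field \<Rightarrow> 'a::comm_ring_1 \<Rightarrow> 'a) \<Rightarrow> nat \<Rightarrow> 'a \<Rightarrow> ('a list \<Rightarrow>\<^sub>0 'k) set"
  where "bracket scale n b =
    (\<Oplus>\<^bsub>tensor_power scale n\<^esub>i\<in>{..<n}. pure_tensor scale n ((replicate n 1)[i := b]))"

section \<open>Indecomposable elements and generating systems of graded rings\<close>

definition positive_part :: "('r, 'm) ring_scheme \<Rightarrow> (nat \<Rightarrow> 'r set) \<Rightarrow> 'r set"
  where "positive_part R C =
    {finsum R x D | x D. finite D \<and> 0 \<notin> D \<and> (\<forall>d\<in>D. x d \<in> C d)}"

definition indecomposable :: "('r, 'm) ring_scheme \<Rightarrow> (nat \<Rightarrow> 'r set) \<Rightarrow> 'r \<Rightarrow> bool"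
  where "indecomposable R C r \<longleftrightarrow>
    (\<exists>d. r \<in> C d) \<and> r \<in> positive_part R C \<and>
    r \<notin> positive_part R C \<cdot>\<^bsub>R\<^esub> positive_part R C"

text \<open>
  Here \<open>S\<close> is the image of the base field in \<open>R\<close>, so that the \<open>K\<close>-subalgebra generated by \<open>G\<close> is
  the subring generated by \<open>S \<union> G\<close>.
\<close>

definition generating_system :: "('r, 'm) ring_scheme \<Rightarrow> 'r set \<Rightarrow> 'r set \<Rightarrow> bool"
  where "generating_system R S G \<longleftrightarrow> generate_ring R (S \<union> G) = carrier R"

definition minimal_homogeneous_generating_system ::
  "('r, 'm) ring_scheme \<Rightarrow> 'r set \<Rightarrow> (nat \<Rightarrow> 'r set) \<Rightarrow> 'r set \<Rightarrow> bool"
  where "minimal_homogeneous_generating_system R S C G \<longleftrightarrow>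
    G \<subseteq> (\<Union>d. C d) \<and> generating_system R S G \<and> (\<forall>H. H \<subset> G \<longrightarrow> \<not> generating_system R S H)"

section \<open>Well-definedness\<close>

text \<open>
  The relations form an ideal, the tensor power is a commutative ring, and the invariants form a
  subring containing the elements \<open>bracket scale n b\<close>.
\<close>

lemma lookup_free_smult [simp]: "Poly_Mapping.lookup (free_smult c f) u = c * Poly_Mapping.lookup f u"
  by (simp add: free_smult_def Poly_Mapping.map.rep_eq when_def)

interpretation free_space: vector_space "free_smult :: 'k::field \<Rightarrow> ('a list \<Rightarrow>\<^sub>0 'k) \<Rightarrow> ('a list \<Rightarrow>\<^sub>0 'k)"
  by unfold_locales (auto intro!: poly_mapping_eqI simp: lookup_add algebra_simps)

lemma free_smult_single [simp]:
  "free_smult c (Poly_Mapping.single u d) = Poly_Mapping.single u (c * d)"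
  by (rule poly_mapping_eqI) (simp add: lookup_single when_def)

lemma sum_single_keys:
  fixes f :: "'a \<Rightarrow>\<^sub>0 'b::comm_monoid_add"
  shows "(\<Sum>u\<in>Poly_Mapping.keys f. Poly_Mapping.single u (Poly_Mapping.lookup f u)) = f"
  by (rule poly_mapping_eqI) (auto simp: lookup_sum lookup_single when_def in_keys_iff)

lemma free_mult_0 [simp]: "free_mult 0 g = 0" "free_mult f 0 = 0"
  by (auto simp: free_mult_def)

lemma free_mult_add_left: "free_mult (f + f') g = free_mult f g + free_mult f' g"
  unfolding free_mult_def
  by (rule setsum_keys_plus_distrib) (auto simp: sum.distrib single_add distrib_right)

lemma free_mult_add_right: "free_mult f (g + g') = free_mult f g + free_mult f g'"
  unfolding free_mult_def sum.distrib [symmetric]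
  by (intro sum.cong refl setsum_keys_plus_distrib) (auto simp: single_add distrib_left)

lemma free_mult_sum_left: "free_mult (\<Sum>i\<in>I. h i) g = (\<Sum>i\<in>I. free_mult (h i) g)"
  by (induction I rule: infinite_finite_induct) (auto simp: free_mult_add_left)

lemma free_mult_sum_right: "free_mult f (\<Sum>i\<in>I. h i) = (\<Sum>i\<in>I. free_mult f (h i))"
  by (induction I rule: infinite_finite_induct) (auto simp: free_mult_add_right)

lemma free_mult_single [simp]:
  "free_mult (Poly_Mapping.single u c) (Poly_Mapping.single v d) =
    Poly_Mapping.single (map2 (*) u v) (c * d)"
  by (cases "c = 0"; cases "d = 0") (auto simp: free_mult_def)

lemma poly_mapping_single_induct [case_names zero single add]:
  fixes f :: "'a \<Rightarrow>\<^sub>0 'b::comm_monoid_add"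
  assumes "P 0" and "\<And>u c. u \<in> Poly_Mapping.keys f \<Longrightarrow> P (Poly_Mapping.single u c)"
    and "\<And>g h. P g \<Longrightarrow> P h \<Longrightarrow> P (g + h)"
  shows "P f"
proof -
  have "P (\<Sum>u\<in>U. Poly_Mapping.single u (Poly_Mapping.lookup f u))"
    if "U \<subseteq> Poly_Mapping.keys f" for U
    using finite_subset [OF that finite_keys] that
    by (induction U rule: finite_induct) (auto intro: assms)
  from this [of "Poly_Mapping.keys f"] show ?thesis
    by (simp add: sum_single_keys)
qed

lemma map2_times_assoc:
  "map2 (*) (map2 (*) u v) w = map2 (*) u (map2 (*) v (w :: 'a::comm_ring_1 list))"
  by (rule nth_equalityI) (auto simp: mult.assoc)

lemma map2_times_commute: "map2 (*) u v = map2 (*) v (u :: 'a::comm_ring_1 list)"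
  by (rule nth_equalityI) (auto simp: mult.commute)

lemma map2_times_one: "length u = n \<Longrightarrow> map2 (*) (replicate n 1) u = (u :: 'a::comm_ring_1 list)"
  by (rule nth_equalityI) auto

lemma free_mult_assoc: "free_mult (free_mult f g) h = free_mult f (free_mult g h)"
proof (induction f rule: poly_mapping_single_induct)
  case (single u c)
  show ?case
  proof (induction g rule: poly_mapping_single_induct)
    case (single v d)
    show ?case
      by (induction h rule: poly_mapping_single_induct)
        (simp_all add: free_mult_add_left free_mult_add_right map2_times_assoc mult.assoc)
  qed (simp_all add: free_mult_add_left free_mult_add_right)
qed (simp_all add: free_mult_add_left free_mult_add_right)

lemma free_mult_commute: "free_mult f g = free_mult g f"
proof (induction f rule: poly_mapping_single_induct)
  case (single u c)
  show ?case
    by (induction g rule: poly_mapping_single_induct)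
      (simp_all add: free_mult_add_left free_mult_add_right mult.commute
        map2_times_commute [of u])
qed (simp_all add: free_mult_add_left free_mult_add_right)

lemma free_algebra_simps:
  "f \<in> carrier (free_algebra n) \<longleftrightarrow> (\<forall>u\<in>Poly_Mapping.keys f. length u = n)"
  "f \<otimes>\<^bsub>free_algebra n\<^esub> g = free_mult f g"
  "f \<oplus>\<^bsub>free_algebra n\<^esub> g = f + g"
  "\<one>\<^bsub>free_algebra n\<^esub> = Poly_Mapping.single (replicate n 1) 1"
  "\<zero>\<^bsub>free_algebra n\<^esub> = 0"
  by (simp_all add: free_algebra_def)

lemma keys_free_mult:
  "Poly_Mapping.keys (free_mult f g) \<subseteq>
    (\<lambda>(u, v). map2 (*) u v) ` (Poly_Mapping.keys f \<times> Poly_Mapping.keys g)"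
proof
  fix w assume "w \<in> Poly_Mapping.keys (free_mult f g)"
  then have "Poly_Mapping.lookup (free_mult f g) w \<noteq> 0"
    by (simp add: in_keys_iff)
  then obtain u v where "u \<in> Poly_Mapping.keys f" "v \<in> Poly_Mapping.keys g" "w = map2 (*) u v"
    unfolding free_mult_def lookup_sum lookup_single
    by (auto elim!: sum.not_neutral_contains_not_neutral simp: when_def split: if_splits)
  then show "w \<in> (\<lambda>(u, v). map2 (*) u v) ` (Poly_Mapping.keys f \<times> Poly_Mapping.keys g)"
    by auto
qed

lemma free_mult_closed:
  "f \<in> carrier (free_algebra n) \<Longrightarrow> g \<in> carrier (free_algebra n) \<Longrightarrow>
    free_mult f g \<in> carrier (free_algebra n)"
  using keys_free_mult [of f g] by (fastforce simp: free_algebra_simps)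

lemma free_mult_one:
  "f \<in> carrier (free_algebra n) \<Longrightarrow> free_mult (Poly_Mapping.single (replicate n 1) 1) f = f"
proof -
  assume f: "f \<in> carrier (free_algebra n)"
  have "free_mult (Poly_Mapping.single (replicate n 1) 1) f =
    (\<Sum>u\<in>Poly_Mapping.keys f. Poly_Mapping.single (map2 (*) (replicate n 1) u) (Poly_Mapping.lookup f u))"
    by (simp add: free_mult_def)
  also have "\<dots> = (\<Sum>u\<in>Poly_Mapping.keys f. Poly_Mapping.single u (Poly_Mapping.lookup f u))"
    using f by (intro sum.cong refl) (auto simp: free_algebra_simps map2_times_one)
  finally show ?thesis
    by (simp add: sum_single_keys)
qed

lemma cring_free_algebra: "cring (free_algebra n :: ('a::comm_ring_1 list \<Rightarrow>\<^sub>0 'k::field) ring)"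
    (is "cring ?F")
proof (rule cringI)
  show "abelian_group ?F"
  proof (rule abelian_groupI)
    fix f assume "f \<in> carrier ?F"
    then show "\<exists>g\<in>carrier ?F. g \<oplus>\<^bsub>?F\<^esub> f = \<zero>\<^bsub>?F\<^esub>"
      by (intro bexI [of _ "- f"]) (auto simp: free_algebra_simps in_keys_iff)
  next
    fix f g assume "f \<in> carrier ?F" "g \<in> carrier ?F"
    then show "f \<oplus>\<^bsub>?F\<^esub> g \<in> carrier ?F"
      using Poly_Mapping.keys_add [of f g] by (auto simp: free_algebra_simps)
  qed (auto simp: free_algebra_simps add_ac)
  show "comm_monoid ?F"
  proof (rule comm_monoidI)
    show "\<one>\<^bsub>?F\<^esub> \<in> carrier ?F"
      by (auto simp: free_algebra_simps)
  qed (auto simp: free_algebra_simps(2,4) free_mult_closed free_mult_one free_mult_assoc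
        intro: free_mult_commute)
qed (auto simp: free_algebra_simps free_mult_add_left)

lemma free_mult_smult_right: "free_mult f (free_smult c g) = free_smult c (free_mult f g)"
proof (induction f rule: poly_mapping_single_induct)
  case (single u d)
  show ?case
    by (induction g rule: poly_mapping_single_induct)
      (simp_all add: free_mult_add_right free_space.scale_right_distrib mult.left_commute)
qed (simp_all add: free_mult_add_left free_space.scale_right_distrib)

lemma free_mult_diff_right: "free_mult f (g - g') = free_mult f g - free_mult f g'"
  using free_mult_add_right [of f "g - g'" g'] by simp

lemma map2_times_update:
  "length u = length v \<Longrightarrow> i < length u \<Longrightarrow>
    map2 (*) v (u[i := z]) = (map2 (*) v u)[i := v ! i * (z :: 'a::comm_ring_1)]"
  by (rule nth_equalityI) (auto simp: nth_list_update)

lemma free_permute_add: "free_permute p (f + g) = free_permute p f + free_permute p g"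
  unfolding free_permute_def by (rule setsum_keys_plus_distrib) (auto simp: single_add)

lemma free_permute_0 [simp]: "free_permute p 0 = 0"
  by (simp add: free_permute_def)

lemma free_permute_diff: "free_permute p (f - g) = free_permute p f - free_permute p g"
  using free_permute_add [of p "f - g" g] by simp

lemma free_permute_sum: "free_permute p (\<Sum>i\<in>I. h i) = (\<Sum>i\<in>I. free_permute p (h i))"
  by (induction I rule: infinite_finite_induct) (auto simp: free_permute_add)

lemma free_permute_single [simp]:
  "free_permute p (Poly_Mapping.single u c) = Poly_Mapping.single (permute_list p u) c"
  by (cases "c = 0") (auto simp: free_permute_def)

lemma free_permute_smult: "free_permute p (free_smult c f) = free_smult c (free_permute p f)"
  by (induction f rule: poly_mapping_single_induct)
    (simp_all add: free_permute_add free_space.scale_right_distrib)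

lemma free_permute_closed:
  "f \<in> carrier (free_algebra n) \<Longrightarrow> free_permute p f \<in> carrier (free_algebra n)"
proof -
  assume f: "f \<in> carrier (free_algebra n)"
  have "length w = n" if "w \<in> Poly_Mapping.keys (free_permute p f)" for w
  proof -
    from that have "Poly_Mapping.lookup (free_permute p f) w \<noteq> 0"
      by (simp add: in_keys_iff)
    then obtain u where "u \<in> Poly_Mapping.keys f" "w = permute_list p u"
      unfolding free_permute_def lookup_sum lookup_single
      by (auto elim!: sum.not_neutral_contains_not_neutral simp: when_def split: if_splits)
    with f show ?thesis by (auto simp: free_algebra_simps)
  qed
  then show ?thesis by (auto simp: free_algebra_simps)
qed

lemma permute_list_map2:
  "p permutes {..<n} \<Longrightarrow> length u = n \<Longrightarrow> length v = n \<Longrightarrow>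
    permute_list p (map2 h u v) = map2 h (permute_list p u) (permute_list p v)"
  by (simp add: permute_list_map permute_list_zip)

lemma permute_list_update:
  assumes "p permutes {..<n}" "length u = n" "i < n"
  shows "permute_list p (u[i := x]) = (permute_list p u)[inv_into UNIV p i := x]"
proof (rule nth_equalityI)
  fix j assume "j < length (permute_list p (u[i := x]))"
  moreover have "inv_into UNIV p i = j \<longleftrightarrow> p j = i"
    using permutes_inv_eq [OF assms(1)] by blast
  moreover have "inv_into UNIV p i < n"
    using permutes_in_image [OF permutes_inv [OF assms(1)], of i] assms(3) by simp
  moreover have "p j < n \<longleftrightarrow> j < n"
    using permutes_in_image [OF assms(1), of j] by simp
  ultimately show "permute_list p (u[i := x]) ! j = (permute_list p u)[inv_into UNIV p i := x] ! j"
    using assms by (auto simp: permute_list_nth nth_list_update)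
qed simp

lemma free_permute_mult:
  assumes p: "p permutes {..<n}"
    and f: "f \<in> carrier (free_algebra n)" and g: "g \<in> carrier (free_algebra n)"
  shows "free_permute p (free_mult f g) = free_mult (free_permute p f) (free_permute p g)"
proof (induction f rule: poly_mapping_single_induct)
  case (single u c)
  with f have u: "length u = n" by (simp add: free_algebra_simps)
  show ?case
  proof (induction g rule: poly_mapping_single_induct)
    case (single v d)
    with g have "length v = n" by (simp add: free_algebra_simps)
    with p u show ?case by (simp add: permute_list_map2)
  qed (simp_all add: free_mult_add_right free_permute_add)
qed (simp_all add: free_mult_add_left free_permute_add)

lemma free_permute_inverse:
  assumes p: "p permutes {..<n}" and f: "f \<in> carrier (free_algebra n)"
  shows "free_permute p (free_permute (inv_into UNIV p) f) = f"
proof (induction f rule: poly_mapping_single_induct)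
  case (single u c)
  with f have "length u = n" by (simp add: free_algebra_simps)
  with p have "permute_list p (permute_list (inv_into UNIV p) u) = permute_list (inv_into UNIV p \<circ> p) u"
    by (subst permute_list_compose) auto
  then show ?case
    using permutes_inv_o(2) [OF p] by simp
qed (simp_all add: free_permute_add)

context connected_graded_algebra
begin

lemma scale_mult_right: "x * scale c y = scale c (x * y)"
  using scale_mult_left [of c y x] by (simp add: mult.commute)

lemma tensor_rel_closed: "f \<in> tensor_rel scale n \<Longrightarrow> f \<in> carrier (free_algebra n)"
proof -
  have *: "r \<in> carrier (free_algebra n)" if "r \<in> multilinear_rels scale n" for r
  proof -
    have "Poly_Mapping.lookup r u = 0" if "length u \<noteq> n" for u
      using \<open>r \<in> multilinear_rels scale n\<close> that
      by cases (auto simp: lookup_minus lookup_single when_def)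
    then show ?thesis by (auto simp: free_algebra_simps in_keys_iff)
  qed
  have "free_space.subspace (carrier (free_algebra n :: ('a list \<Rightarrow>\<^sub>0 'k) ring))"
  proof (rule free_space.subspaceI)
    fix f g :: "'a list \<Rightarrow>\<^sub>0 'k" and c :: 'k
    assume f: "f \<in> carrier (free_algebra n)"
    then show "free_smult c f \<in> carrier (free_algebra n)"
      by (auto simp: free_algebra_simps in_keys_iff)
    assume "g \<in> carrier (free_algebra n)"
    with f show "f + g \<in> carrier (free_algebra n)"
      using Poly_Mapping.keys_add [of f g] by (auto simp: free_algebra_simps)
  qed (auto simp: free_algebra_simps)
  with * have "tensor_rel scale n \<subseteq> carrier (free_algebra n)"
    unfolding tensor_rel_def by (intro free_space.span_minimal) auto
  then show "f \<in> tensor_rel scale n \<Longrightarrow> f \<in> carrier (free_algebra n)" by auto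
qed

lemma single_mult_multilinear_rel:
  assumes "r \<in> multilinear_rels scale n" and v: "length v = n"
  shows "free_mult (Poly_Mapping.single v c) r \<in> tensor_rel scale n"
  using assms(1)
proof cases
  case (add u i x y)
  have "free_mult (Poly_Mapping.single v c) r = free_smult c
    (Poly_Mapping.single ((map2 (*) v u)[i := v ! i * x + v ! i * y]) 1
      - Poly_Mapping.single ((map2 (*) v u)[i := v ! i * x]) 1
      - Poly_Mapping.single ((map2 (*) v u)[i := v ! i * y]) 1)"
    using add v by (simp add: free_mult_diff_right map2_times_update free_space.scale_right_diff_distrib
        distrib_left)
  also have "\<dots> \<in> tensor_rel scale n"
    unfolding tensor_rel_def using add v
    by (intro free_space.span_scale free_space.span_base multilinear_rels.add) auto
  finally show ?thesis .
next
  case (scale u i d x)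
  have "free_mult (Poly_Mapping.single v c) r = free_smult c
    (Poly_Mapping.single ((map2 (*) v u)[i := scale d (v ! i * x)]) 1
      - Poly_Mapping.single ((map2 (*) v u)[i := v ! i * x]) d)"
    using scale v by (simp add: free_mult_diff_right map2_times_update free_space.scale_right_diff_distrib
        scale_mult_right)
  also have "\<dots> \<in> tensor_rel scale n"
    unfolding tensor_rel_def using scale v
    by (intro free_space.span_scale free_space.span_base multilinear_rels.scale) auto
  finally show ?thesis .
qed

lemma free_mult_tensor_rel:
  assumes r: "r \<in> tensor_rel scale n" and f: "f \<in> carrier (free_algebra n)"
  shows "free_mult f r \<in> tensor_rel scale n"
proof (induction f rule: poly_mapping_single_induct)
  case zero
  then show ?case by (simp add: tensor_rel_def free_space.span_zero)
next
  case (add g h)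
  then show ?case by (simp add: free_mult_add_left tensor_rel_def free_space.span_add)
next
  case (single v c)
  with f have v: "length v = n" by (simp add: free_algebra_simps)
  show ?case
    using r [unfolded tensor_rel_def]
  proof (induction rule: free_space.span_induct_alt)
    case base
    then show ?case by (simp add: tensor_rel_def free_space.span_zero)
  next
    case (step d x y)
    then show ?case
      using single_mult_multilinear_rel [OF step(1) v, of c]
      by (simp add: free_mult_add_right free_mult_smult_right tensor_rel_def free_space.span_add
          free_space.span_scale)
  qed
qed

lemma ideal_tensor_rel: "ideal (tensor_rel scale n) (free_algebra n)"
proof (rule idealI)
  interpret cring "free_algebra n :: ('a list \<Rightarrow>\<^sub>0 'k) ring"
    by (rule cring_free_algebra)
  show "ring (free_algebra n :: ('a list \<Rightarrow>\<^sub>0 'k) ring)"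
    by (rule ring_axioms)
  show "subgroup (tensor_rel scale n) (add_monoid (free_algebra n))"
  proof (rule add.subgroupI)
    show "tensor_rel scale n \<noteq> {}"
      using free_space.span_zero by (auto simp: tensor_rel_def)
  next
    fix f assume f: "f \<in> tensor_rel scale n"
    then have "- f \<in> tensor_rel scale n"
      by (simp add: tensor_rel_def free_space.span_neg)
    moreover have "\<ominus>\<^bsub>free_algebra n\<^esub> f = - f"
      using f \<open>- f \<in> tensor_rel scale n\<close>
      by (intro minus_equality) (auto simp: tensor_rel_closed free_algebra_simps(3,5))
    ultimately show "\<ominus>\<^bsub>free_algebra n\<^esub> f \<in> tensor_rel scale n" by simp
  next
    fix f g assume "f \<in> tensor_rel scale n" "g \<in> tensor_rel scale n"
    then show "f \<oplus>\<^bsub>free_algebra n\<^esub> g \<in> tensor_rel scale n"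
      by (simp add: free_algebra_simps(3) tensor_rel_def free_space.span_add)
  qed (use tensor_rel_closed in auto)
next
  fix f g :: "'a list \<Rightarrow>\<^sub>0 'k" assume f: "f \<in> tensor_rel scale n" and g: "g \<in> carrier (free_algebra n)"
  show "g \<otimes>\<^bsub>free_algebra n\<^esub> f \<in> tensor_rel scale n"
    using free_mult_tensor_rel [OF f g] by (simp add: free_algebra_simps(2))
  then show "f \<otimes>\<^bsub>free_algebra n\<^esub> g \<in> tensor_rel scale n"
    by (simp add: free_algebra_simps(2) free_mult_commute [of f])
qed

lemma cring_tensor_power: "cring (tensor_power scale n)"
  unfolding tensor_power_def
  by (rule ideal.quotient_is_cring [OF ideal_tensor_rel cring_free_algebra])

lemma carrier_tensor_power: "carrier (tensor_power scale n) = tensor_class scale n ` carrier (free_algebra n)"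
  by (auto simp: tensor_power_def tensor_class_def FactRing_def A_RCOSETS_def RCOSETS_def a_r_coset_def)

lemma tensor_class_hom: "tensor_class scale n \<in> ring_hom (free_algebra n) (tensor_power scale n)"
  unfolding tensor_power_def tensor_class_def
  using ideal.rcos_ring_hom [OF ideal_tensor_rel] by simp

lemma tensor_class_eq:
  "tensor_class scale n f = (\<lambda>r. r + f) ` tensor_rel scale n"
  by (auto simp: tensor_class_def a_r_coset_def r_coset_def free_algebra_def)

lemma free_permute_tensor_rel:
  assumes p: "p permutes {..<n}"
  shows "free_permute p ` tensor_rel scale n = tensor_rel scale n"
proof -
  have rel: "free_permute p r \<in> multilinear_rels scale n"
    if p: "p permutes {..<n}" and r: "r \<in> multilinear_rels scale n" for p r
    using r
  proof cases
    case (add u i x y)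
    have "inv_into UNIV p i < n"
      using permutes_in_image [OF permutes_inv [OF p], of i] add by simp
    with add p show ?thesis
      by (simp add: free_permute_diff permute_list_update [OF p] multilinear_rels.add)
  next
    case (scale u i c x)
    have "inv_into UNIV p i < n"
      using permutes_in_image [OF permutes_inv [OF p], of i] scale by simp
    with scale p show ?thesis
      by (simp add: free_permute_diff permute_list_update [OF p] multilinear_rels.scale)
  qed
  have sub: "free_permute p r \<in> tensor_rel scale n"
    if p: "p permutes {..<n}" and r: "r \<in> tensor_rel scale n" for p r
    using r unfolding tensor_rel_def
  proof (induction rule: free_space.span_induct_alt)
    case (step c x y)
    then show ?case
      using rel [OF p step(1)]
      by (simp add: free_permute_add free_permute_smult free_space.span_add free_space.span_scale
          free_space.span_base)
  qed (simp add: free_space.span_zero)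
  show ?thesis
  proof
    show "tensor_rel scale n \<subseteq> free_permute p ` tensor_rel scale n"
    proof
      fix r assume r: "r \<in> tensor_rel scale n"
      then have "r = free_permute p (free_permute (inv_into UNIV p) r)"
        using free_permute_inverse [OF p tensor_rel_closed] by simp
      with sub [OF permutes_inv [OF p] r] show "r \<in> free_permute p ` tensor_rel scale n"
        by blast
    qed
  qed (use sub [OF p] in auto)
qed

lemma free_permute_tensor_class:
  assumes "p permutes {..<n}"
  shows "free_permute p ` tensor_class scale n f = tensor_class scale n (free_permute p f)"
proof -
  have "free_permute p ` tensor_class scale n f =
    (\<lambda>r. r + free_permute p f) ` free_permute p ` tensor_rel scale n"
    by (simp add: tensor_class_eq image_image free_permute_add)
  then show ?thesis
    by (simp add: free_permute_tensor_rel [OF assms] tensor_class_eq)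
qed

lemma sym_invariantsI:
  assumes "f \<in> carrier (free_algebra n)"
    and "\<And>p. p permutes {..<n} \<Longrightarrow> tensor_class scale n (free_permute p f) = tensor_class scale n f"
  shows "tensor_class scale n f \<in> carrier (sym_invariants scale n)"
  using assms unfolding sym_invariants_def carrier_tensor_power
  by (simp add: free_permute_tensor_class)

lemma sym_invariantsE:
  assumes "X \<in> carrier (sym_invariants scale n)"
  obtains f where "f \<in> carrier (free_algebra n)" "X = tensor_class scale n f"
    "\<And>p. p permutes {..<n} \<Longrightarrow> tensor_class scale n (free_permute p f) = tensor_class scale n f"
proof -
  have "X \<in> tensor_class scale n ` carrier (free_algebra n)"
    and X: "\<And>p. p permutes {..<n} \<Longrightarrow> free_permute p ` X = X"
    using assms by (simp_all add: sym_invariants_def carrier_tensor_power)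
  then obtain f where f: "f \<in> carrier (free_algebra n)" "X = tensor_class scale n f"
    by (elim imageE)
  have "tensor_class scale n (free_permute p f) = tensor_class scale n f" if "p permutes {..<n}" for p
    using X [OF that] free_permute_tensor_class [OF that, of f] f(2) by simp
  with f that show thesis by blast
qed

lemma permute_replicate:
  assumes "p permutes {..<n}"
  shows "permute_list p (replicate n x) = replicate n x"
  using permutes_in_image [OF assms] assms
  by (intro nth_equalityI) (simp_all add: permute_list_nth)

lemma subring_sym_invariants:
  "subring (carrier (sym_invariants scale n)) (tensor_power scale n)"
proof -
  let ?T = "tensor_power scale n" and ?F = "free_algebra n :: ('a list \<Rightarrow>\<^sub>0 'k) ring"
  interpret T: cring ?T by (rule cring_tensor_power)
  interpret F: cring ?F by (rule cring_free_algebra)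
  interpret h: ring_hom_ring ?F ?T "tensor_class scale n"
    by (rule ring_hom_ringI2) (auto simp: F.ring_axioms T.ring_axioms tensor_class_hom)
  show ?thesis
  proof (rule T.subringI)
    show "carrier (sym_invariants scale n) \<subseteq> carrier ?T"
      by (auto simp: sym_invariants_def)
    have "free_permute p \<one>\<^bsub>?F\<^esub> = \<one>\<^bsub>?F\<^esub>" if "p permutes {..<n}" for p
      using that by (simp add: free_algebra_simps permute_replicate)
    then show "\<one>\<^bsub>?T\<^esub> \<in> carrier (sym_invariants scale n)"
      using sym_invariantsI [OF F.one_closed] h.hom_one by simp
  next
    fix X assume "X \<in> carrier (sym_invariants scale n)"
    then obtain f where f: "f \<in> carrier ?F" "X = tensor_class scale n f"
      "\<And>p. p permutes {..<n} \<Longrightarrow> tensor_class scale n (free_permute p f) = tensor_class scale n f"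
      by (rule sym_invariantsE) blast
    have minus: "\<ominus>\<^bsub>?F\<^esub> g = - g" if "g \<in> carrier ?F" for g
      using that by (intro F.minus_equality) (auto simp: free_algebra_simps in_keys_iff)
    have "tensor_class scale n (free_permute p (\<ominus>\<^bsub>?F\<^esub> f)) = tensor_class scale n (\<ominus>\<^bsub>?F\<^esub> f)"
      if p: "p permutes {..<n}" for p
    proof -
      have "free_permute p (\<ominus>\<^bsub>?F\<^esub> f) = \<ominus>\<^bsub>?F\<^esub> free_permute p f"
        using f(1) free_permute_closed [OF f(1), of p] free_permute_diff [of p 0 f] by (simp add: minus)
      then show ?thesis
        using f(1) f(3) [OF p] free_permute_closed [OF f(1), of p] by (simp add: h.hom_a_inv)
    qed
    then show "\<ominus>\<^bsub>?T\<^esub> X \<in> carrier (sym_invariants scale n)"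
      using sym_invariantsI [OF F.a_inv_closed [OF f(1)]] f(1,2) by (simp add: h.hom_a_inv)
    fix Y assume "Y \<in> carrier (sym_invariants scale n)"
    then obtain g where g: "g \<in> carrier ?F" "Y = tensor_class scale n g"
      "\<And>p. p permutes {..<n} \<Longrightarrow> tensor_class scale n (free_permute p g) = tensor_class scale n g"
      by (rule sym_invariantsE) blast
    have "tensor_class scale n (free_permute p (f \<oplus>\<^bsub>?F\<^esub> g)) = tensor_class scale n (f \<oplus>\<^bsub>?F\<^esub> g)"
      if p: "p permutes {..<n}" for p
    proof -
      have "free_permute p (f \<oplus>\<^bsub>?F\<^esub> g) = free_permute p f \<oplus>\<^bsub>?F\<^esub> free_permute p g"
        by (simp add: free_algebra_simps free_permute_add)
      then show ?thesis
        using f(1) g(1) f(3) [OF p] g(3) [OF p] free_permute_closed [OF f(1), of p]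
          free_permute_closed [OF g(1), of p] by simp
    qed
    then show "X \<oplus>\<^bsub>?T\<^esub> Y \<in> carrier (sym_invariants scale n)"
      using sym_invariantsI [OF F.a_closed [OF f(1) g(1)]] f(1,2) g(1,2) by (simp add: h.hom_add)
    have "tensor_class scale n (free_permute p (f \<otimes>\<^bsub>?F\<^esub> g)) = tensor_class scale n (f \<otimes>\<^bsub>?F\<^esub> g)"
      if p: "p permutes {..<n}" for p
    proof -
      have "free_permute p (f \<otimes>\<^bsub>?F\<^esub> g) = free_permute p f \<otimes>\<^bsub>?F\<^esub> free_permute p g"
        using free_permute_mult [OF p f(1) g(1)] by (simp add: free_algebra_simps(2))
      then show ?thesis
        using f(1) g(1) f(3) [OF p] g(3) [OF p] free_permute_closed [OF f(1), of p]
          free_permute_closed [OF g(1), of p] by simp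
    qed
    then show "X \<otimes>\<^bsub>?T\<^esub> Y \<in> carrier (sym_invariants scale n)"
      using sym_invariantsI [OF F.m_closed [OF f(1) g(1)]] f(1,2) g(1,2) by (simp add: h.hom_mult)
  qed
qed

lemma cring_sym_invariants: "cring (sym_invariants scale n)"
proof -
  interpret T: cring "tensor_power scale n" by (rule cring_tensor_power)
  have "subcring (carrier (sym_invariants scale n)) (tensor_power scale n)"
    by (rule T.subcringI' [OF subring_sym_invariants])
  then have "cring ((tensor_power scale n)\<lparr>carrier := carrier (sym_invariants scale n)\<rparr>)"
    using T.subcring_iff subring_sym_invariants subringE(1) by blast
  then show ?thesis by (simp add: sym_invariants_def)
qed

lemma bracket_eq:
  "bracket scale n b = tensor_class scale n (\<Sum>i<n. Poly_Mapping.single ((replicate n 1)[i := b]) 1)"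
proof -
  let ?T = "tensor_power scale n" and ?F = "free_algebra n :: ('a list \<Rightarrow>\<^sub>0 'k) ring"
  interpret T: cring ?T by (rule cring_tensor_power)
  interpret F: cring ?F by (rule cring_free_algebra)
  interpret h: ring_hom_ring ?F ?T "tensor_class scale n"
    by (rule ring_hom_ringI2) (auto simp: F.ring_axioms T.ring_axioms tensor_class_hom)
  let ?e = "\<lambda>i. Poly_Mapping.single ((replicate n 1)[i := b]) 1 :: 'a list \<Rightarrow>\<^sub>0 'k"
  have e: "?e i \<in> carrier ?F" for i by (simp add: free_algebra_simps)
  have "finsum ?F ?e I = sum ?e I" if "finite I" for I
    using that e by (induction I) (simp_all add: F.finsum_insert free_algebra_simps(3,5))
  then have "(\<Sum>i<n. ?e i) = finsum ?F ?e {..<n}" by simp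
  then show ?thesis
    using e by (simp add: bracket_def pure_tensor_def h.hom_finsum o_def)
qed

lemma bracket_in_sym_comp:
  assumes "b \<in> A d"
  shows "bracket scale n b \<in> sym_comp scale A n d"
proof -
  let ?e = "\<lambda>i. Poly_Mapping.single ((replicate n 1)[i := b]) 1 :: 'a list \<Rightarrow>\<^sub>0 'k"
  have keys: "\<exists>i<n. u = (replicate n 1)[i := b]" if "u \<in> Poly_Mapping.keys (\<Sum>i<n. ?e i)" for u
  proof -
    from that have "(\<Sum>i<n. Poly_Mapping.lookup (?e i) u) \<noteq> 0"
      by (simp add: in_keys_iff lookup_sum)
    then show ?thesis
      by (auto elim!: sum.not_neutral_contains_not_neutral simp: lookup_single when_def
          split: if_splits)
  qed
  have "1 \<in> A 0"
    using comp_0 scale_one [of 1] by (metis rangeI)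
  then have "\<exists>ds. length ((replicate n 1)[i := b]) = n \<and> length ds = n \<and> sum_list ds = d \<and>
      (\<forall>j<n. (replicate n 1)[i := b] ! j \<in> A (ds ! j))" if "i < n" for i
    using that assms
    by (intro exI [of _ "(replicate n 0)[i := d]"]) (auto simp: nth_list_update sum_list_update)
  then have "bracket scale n b \<in> tensor_comp scale A n d"
    unfolding bracket_eq tensor_comp_def by (intro imageI CollectI ballI) (metis keys)
  moreover have "free_permute p (\<Sum>i<n. ?e i) = (\<Sum>i<n. ?e i)" if p: "p permutes {..<n}" for p
  proof -
    from p have "free_permute p (\<Sum>i<n. ?e i) = (\<Sum>i<n. ?e (inv_into UNIV p i))"
      by (simp add: free_permute_sum permute_list_update [OF p] permute_replicate)
    also have "\<dots> = (\<Sum>i<n. ?e i)"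
      using sum.permute [OF permutes_inv [OF p], of ?e] by (simp add: o_def)
    finally show ?thesis .
  qed
  then have "bracket scale n b \<in> carrier (sym_invariants scale n)"
    unfolding bracket_eq using keys by (intro sym_invariantsI) (auto simp: free_algebra_simps(1) dest!: keys)
  ultimately show ?thesis by (simp add: sym_comp_def)
qed

end

end

theory Submission
  imports Defs
begin

text \<open>
  Write \<open>R\<close> for the algebra of invariants, \<open>R\<^sub>+\<close> for its part of positive degree and \<open>A\<^sub>+\<close> for that of
  \<open>A\<close>.  Both claims follow from a linear map \<open>R \<rightarrow> A\<close> that sends \<open>[b]\<close> to \<open>b\<close> whenever
  \<open>0 < deg b < (n + 1) q\<close> and that vanishes on \<open>(R\<^sub>+)\<^sup>2\<close>.  Such a map is a logarithm.  A product of
  more than \<open>n\<close> elements of \<open>A\<^sub>+\<close> has order at least \<open>(n + 1) q\<close>, so below that degree the truncated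
  series \<open>\<Sum>k=1..n. (-1)^(k-1) x^k / k\<close> is a genuine logarithm of \<open>1 + x\<close> for \<open>x\<close> in \<open>A\<^sub>+\<close>.  Sending
  the tensor \<open>(1 + x) \<otimes> \<dots> \<otimes> (1 + x)\<close> to it turns products into sums, so the linear map determined by
  this is a derivation along the augmentation \<open>R \<rightarrow> K\<close>, and derivations along the augmentation kill
  \<open>(R\<^sub>+)\<^sup>2\<close>.  The polarized form of this map is defined on all tensors, and its denominators divide
  \<open>n!\<close>, which is invertible in \<open>K\<close>.

  The proof that \<open>(R\<^sub>+)\<^sup>2\<close> is killed does not pass through power series.  For a tensor \<open>y\<close> the weights in
  the polarized form cancel so that the logarithm of \<open>[b] y\<close> equals \<open>b\<close> times the augmentation of \<open>y\<close>,
  up to terms of order at least \<open>(n + 1) q\<close> (\<open>log_form_mult_slots\<close>, \<open>low_log_bracket_mult\<close>).  In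
  particular \<open>[b] y\<close> is killed if \<open>y\<close> has positive degree.  Now let \<open>Y\<close> in \<open>R\<^sub>+\<close> and let \<open>u\<close> be a pure
  tensor with \<open>k \<ge> 1\<close> entries in \<open>A\<^sub>+\<close>, one of them \<open>b\<close>, and all others equal to \<open>1\<close>; let \<open>v\<close> arise from \<open>u\<close> by replacing \<open>b\<close> by
  \<open>1\<close>.  Expanding \<open>[b] v Y\<close> gives \<open>n - k + 1\<close> terms that agree with \<open>u Y\<close> up to a permutation of the
  factors, and terms with \<open>k - 1\<close> entries in \<open>A\<^sub>+\<close>; so \<open>u Y\<close> is killed by induction on \<open>k\<close>
  (\<open>symmetric_form_vanishes\<close>, \<open>low_log_mult\<close>).

  Thus \<open>[b]\<close> is indecomposable.  Moreover, linearly independent elements \<open>b\<close> give elements \<open>[b]\<close> that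
  are linearly independent modulo \<open>(R\<^sub>+)\<^sup>2\<close>, hence extend to homogeneous elements of \<open>R\<^sub>+\<close> that form a
  basis modulo \<open>(R\<^sub>+)\<^sup>2\<close>.  By the graded version of Nakayama's lemma these are a minimal generating
  system (\<open>generating_if_spanning\<close>, \<open>minimal_if_independent\<close>).

  Spans and bases are formed in the free space over the tuples; a subspace of the tensor power is
  represented by its full preimage, which contains the span of the multilinearity relations.
\<close>

section \<open>Linear maps on the free space\<close>

abbreviation (input) tuple :: "'a list \<Rightarrow> ('a list \<Rightarrow>\<^sub>0 'k::field)"
  where "tuple u \<equiv> Poly_Mapping.single u 1"

definition linear_extension ::
  "('k::field \<Rightarrow> 'v::ab_group_add \<Rightarrow> 'v) \<Rightarrow> ('a list \<Rightarrow> 'v) \<Rightarrow> ('a list \<Rightarrow>\<^sub>0 'k) \<Rightarrow> 'v"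
  where "linear_extension s h f = (\<Sum>u\<in>Poly_Mapping.keys f. s (Poly_Mapping.lookup f u) (h u))"

lemma linear_extension_single:
  assumes "vector_space s"
  shows "linear_extension s h (Poly_Mapping.single u c) = s c (h u)"
proof -
  interpret vector_space s by fact
  show ?thesis by (cases "c = 0") (auto simp: linear_extension_def)
qed

lemma linear_linear_extension:
  assumes "vector_space s"
  shows "Vector_Spaces.linear free_smult s (linear_extension s h)"
proof -
  interpret vector_space s by fact
  have ext_add: "linear_extension s h (f + g) = linear_extension s h f + linear_extension s h g" for f g
    unfolding linear_extension_def
    by (rule setsum_keys_plus_distrib) (auto simp: scale_left_distrib)
  have "linear_extension s h (free_smult c f) = s c (linear_extension s h f)" for c f
  proof (induction f rule: poly_mapping_single_induct)
    case zero
    then show ?case by (simp add: linear_extension_def)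
  next
    case (single u d)
    then show ?case by (simp add: linear_extension_single[OF assms])
  next
    case (add f g)
    then show ?case by (simp add: free_space.scale_right_distrib ext_add scale_right_distrib)
  qed
  then show ?thesis
    by (simp add: Vector_Spaces.linear_iff ext_add assms free_space.vector_space_axioms)
qed

lemma linear_free_mult_right: "Vector_Spaces.linear free_smult free_smult (free_mult f)"
  by (simp add: Vector_Spaces.linear_iff free_space.vector_space_axioms free_mult_add_right
      free_mult_smult_right)

lemma linear_free_mult_left: "Vector_Spaces.linear free_smult free_smult (\<lambda>f. free_mult f g)"
proof -
  have "(\<lambda>f. free_mult f g) = free_mult g" by (intro ext free_mult_commute)
  then show ?thesis by (simp add: linear_free_mult_right)
qed

lemma linear_free_permute: "Vector_Spaces.linear free_smult free_smult (free_permute p)"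
  by (simp add: Vector_Spaces.linear_iff free_space.vector_space_axioms free_permute_add free_permute_smult)

lemma single_eq_smult_tuple: "Poly_Mapping.single u c = free_smult c (tuple u)"
  by simp

lemma linear_eq_on_carrier:
  assumes "Vector_Spaces.linear free_smult s L" "Vector_Spaces.linear free_smult s M"
    and "f \<in> carrier (free_algebra n)"
    and "\<And>u. length u = n \<Longrightarrow> L (tuple u) = M (tuple u)"
  shows "L f = M f"
proof -
  interpret L: Vector_Spaces.linear free_smult s L by fact
  interpret M: Vector_Spaces.linear free_smult s M by fact
  show ?thesis
  proof (induction f rule: poly_mapping_single_induct)
    case (single u c)
    then have "length u = n" using assms(3) by (simp add: free_algebra_simps)
    then show ?case
      using assms(4)[of u] by (subst (1 2) single_eq_smult_tuple) (simp only: L.scale M.scale)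
  qed (simp_all add: L.zero M.zero L.add M.add)
qed

lemma linear_into_subspace:
  assumes "Vector_Spaces.linear free_smult s L" "module.subspace s W"
    and "\<And>u. u \<in> Poly_Mapping.keys f \<Longrightarrow> L (tuple u) \<in> W"
  shows "L f \<in> W"
proof -
  interpret L: Vector_Spaces.linear free_smult s L by fact
  note sub = L.vs2.subspace_add[OF assms(2)] L.vs2.subspace_scale[OF assms(2)] L.vs2.subspace_0[OF assms(2)]
  show ?thesis
  proof (induction f rule: poly_mapping_single_induct)
    case (single u c)
    then show ?case
      using assms(3)[of u] by (subst single_eq_smult_tuple) (simp only: L.scale sub)
  qed (simp_all add: L.zero L.add sub)
qed

text \<open>
  This is how linear maps descend to the tensor power: it suffices to test linearity in each slot.
  The subspace \<open>W\<close> is \<open>0\<close> for maps into the algebra, and the space of relations itself for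
  endomorphisms of the tensor power.
\<close>

lemma linear_tensor_rel_into_subspace:
  assumes "Vector_Spaces.linear free_smult s L" "module.subspace s W"
    and add: "\<And>u i x y. length u = n \<Longrightarrow> i < n \<Longrightarrow>
      L (tuple (u[i := x + y])) - L (tuple (u[i := x])) - L (tuple (u[i := y])) \<in> W"
    and scale: "\<And>u i c x. length u = n \<Longrightarrow> i < n \<Longrightarrow>
      L (tuple (u[i := scale c x])) - s c (L (tuple (u[i := x]))) \<in> W"
    and r: "r \<in> tensor_rel scale n"
  shows "L r \<in> W"
proof -
  interpret L: Vector_Spaces.linear free_smult s L by fact
  note sub = L.vs2.subspace_add[OF assms(2)] L.vs2.subspace_scale[OF assms(2)] L.vs2.subspace_0[OF assms(2)]
  have rel: "L x \<in> W" if "x \<in> multilinear_rels scale n" for x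
    using that
  proof cases
    case (scale u i c y)
    then show ?thesis
      using assms(4)[of u i c y] single_eq_smult_tuple[of "u[i := y]" c]
      by (simp only: L.diff L.scale)
  qed (use add in \<open>simp add: L.diff\<close>)
  show ?thesis
    using r unfolding tensor_rel_def
    by (induction rule: free_space.span_induct_alt) (simp_all add: L.zero L.add L.scale sub rel)
qed

section \<open>Homogeneous components\<close>

context connected_graded_algebra
begin

definition component :: "nat \<Rightarrow> 'a \<Rightarrow> 'a"
  where "component d x =
    (THE f. finite {d. f d \<noteq> 0} \<and> (\<forall>d. f d \<in> A d) \<and> (\<Sum>d | f d \<noteq> 0. f d) = x) d"

lemma
  shows finite_components: "finite {d. component d x \<noteq> 0}"
    and component_in: "component d x \<in> A d"
    and sum_components: "(\<Sum>d | component d x \<noteq> 0. component d x) = x"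
  using theI'[OF direct_sum[of x]] unfolding component_def by auto

lemma sum_components_superset:
  assumes "finite D" "{d. component d x \<noteq> 0} \<subseteq> D"
  shows "(\<Sum>d\<in>D. component d x) = x"
proof -
  have "(\<Sum>d\<in>D. component d x) = (\<Sum>d | component d x \<noteq> 0. component d x)"
    using assms by (intro sum.mono_neutral_right) auto
  then show ?thesis by (simp add: sum_components)
qed

lemma component_unique:
  assumes "finite {d. f d \<noteq> 0}" "\<And>d. f d \<in> A d" "(\<Sum>d | f d \<noteq> 0. f d) = x"
  shows "component d x = f d"
proof -
  have "(THE f. finite {d. f d \<noteq> 0} \<and> (\<forall>d. f d \<in> A d) \<and> (\<Sum>d | f d \<noteq> 0. f d) = x) = f"
    using assms by (intro the1_equality direct_sum) auto
  then show ?thesis by (simp add: component_def)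
qed

lemma component_homogeneous:
  assumes "x \<in> A d"
  shows "component e x = (if e = d then x else 0)"
proof (rule component_unique)
  have "{e. (if e = d then x else 0) \<noteq> 0} = (if x = 0 then {} else {d})" by auto
  then show "finite {e. (if e = d then x else 0) \<noteq> 0}"
    "(\<Sum>e | (if e = d then x else 0) \<noteq> 0. if e = d then x else 0) = x"
    by simp_all
qed (use assms subspace_0[OF subspace_comp] in auto)

lemma component_add: "component d (x + y) = component d x + component d y"
proof (rule component_unique)
  let ?D = "{d. component d x \<noteq> 0} \<union> {d. component d y \<noteq> 0}"
  have sub: "{d. component d x + component d y \<noteq> 0} \<subseteq> ?D" by auto
  have fin: "finite ?D" by (simp add: finite_components)
  show "finite {d. component d x + component d y \<noteq> 0}"
    using finite_subset[OF sub fin] .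
  have "(\<Sum>d | component d x + component d y \<noteq> 0. component d x + component d y) =
      (\<Sum>d\<in>?D. component d x + component d y)"
    using sub fin by (intro sum.mono_neutral_left) auto
  also have "\<dots> = x + y"
    by (simp add: sum.distrib sum_components_superset[OF fin])
  finally show "(\<Sum>d | component d x + component d y \<noteq> 0. component d x + component d y) = x + y" .
qed (intro subspace_add[OF subspace_comp] component_in)

lemma component_scale: "component d (scale c x) = scale c (component d x)"
proof (rule component_unique)
  let ?D = "{d. component d x \<noteq> 0}"
  have sub: "{d. scale c (component d x) \<noteq> 0} \<subseteq> ?D" by auto
  show "finite {d. scale c (component d x) \<noteq> 0}"
    using finite_subset[OF sub finite_components] .
  have "(\<Sum>d | scale c (component d x) \<noteq> 0. scale c (component d x)) =
      (\<Sum>d\<in>?D. scale c (component d x))"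
    using sub finite_components by (intro sum.mono_neutral_left) auto
  also have "\<dots> = scale c x"
    by (simp add: sum_components flip: scale_sum_right)
  finally show "(\<Sum>d | scale c (component d x) \<noteq> 0. scale c (component d x)) = scale c x" .
qed (intro subspace_scale[OF subspace_comp] component_in)

lemma component_0 [simp]: "component d 0 = 0"
  using component_scale[of d 0 0] by simp

lemma component_diff: "component d (x - y) = component d x - component d y"
  using component_add[of d "x - y" y] by (simp add: algebra_simps)

lemma component_sum: "component d (\<Sum>i\<in>I. x i) = (\<Sum>i\<in>I. component d (x i))"
  by (induction I rule: infinite_finite_induct) (simp_all add: component_add)

lemma one_in_A0: "1 \<in> A 0"
  using comp_0 scale_one[of 1] by (metis rangeI)

lemma in_A0D: "x \<in> A 0 \<Longrightarrow> \<exists>c. x = scale c 1"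
  using comp_0 by auto

subsection \<open>The filtration by order\<close>

text \<open>
  The positive part of an arbitrary element is not homogeneous; its order is what can be controlled.
\<close>

definition order_ge :: "nat \<Rightarrow> 'a set"
  where "order_ge m = {x. \<forall>d<m. component d x = 0}"

lemma order_ge_mult:
  assumes "x \<in> order_ge a" "y \<in> order_ge b"
  shows "x * y \<in> order_ge (a + b)"
proof -
  have "component k (component d x * component e y) = 0" if "k < a + b" for k d e
  proof (cases "d < a \<or> e < b")
    case True
    then show ?thesis using assms by (auto simp: order_ge_def)
  next
    case False
    with that have "k \<noteq> d + e" by auto
    then show ?thesis
      using component_homogeneous[OF comp_mult[OF component_in component_in]] by simp
  qed
  moreover have "x * y = (\<Sum>d | component d x \<noteq> 0. \<Sum>e | component e y \<noteq> 0. component d x * component e y)"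
    by (subst (1) sum_components[of x, symmetric], subst (1) sum_components[of y, symmetric])
      (simp only: sum_product)
  ultimately show ?thesis by (simp add: order_ge_def component_sum)
qed

lemma order_ge_0: "x \<in> order_ge 0"
  by (simp add: order_ge_def)

lemma order_ge_prod:
  assumes "finite I" "\<And>i. i \<in> I \<Longrightarrow> x i \<in> order_ge m"
  shows "(\<Prod>i\<in>I. x i) \<in> order_ge (card I * m)"
  using assms by (induction I rule: finite_induct) (auto simp: order_ge_0 intro: order_ge_mult)

lemma component_0_mult_positive:
  assumes "b \<in> A e" "0 < e"
  shows "component 0 (b * x) = 0"
proof -
  have "b \<in> order_ge 1" using assms by (auto simp: order_ge_def component_homogeneous)
  from order_ge_mult[OF this order_ge_0] show ?thesis by (simp add: order_ge_def)
qed

definition truncation :: "nat \<Rightarrow> 'a \<Rightarrow> 'a"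
  where "truncation m x = (\<Sum>d<m. component d x)"

lemma linear_truncation: "Vector_Spaces.linear scale scale (truncation m)"
  by (auto simp: Vector_Spaces.linear_iff vector_space_axioms truncation_def component_add
      component_scale sum.distrib scale_sum_right)

lemma truncation_order_ge: "x \<in> order_ge m \<Longrightarrow> truncation m x = 0"
  by (simp add: truncation_def order_ge_def)

lemma truncation_homogeneous: "x \<in> A d \<Longrightarrow> d < m \<Longrightarrow> truncation m x = x"
  by (simp add: truncation_def component_homogeneous)

end

section \<open>A logarithm on the tensor power\<close>

context connected_graded_algebra
begin

text \<open>
  For a tensor \<open>u\<close>, project the slots in \<open>S\<close> to the positive part and all other slots to degree zero,
  and multiply the slots.
\<close>

definition slot_product :: "nat \<Rightarrow> nat set \<Rightarrow> 'a list \<Rightarrow> 'a"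
  where "slot_product n S u =
    (\<Prod>i<n. if i \<in> S then u ! i - component 0 (u ! i) else component 0 (u ! i))"

text \<open>
  The coefficient \<open>(-1)^(k-1) / k\<close> of \<open>log (1 + x)\<close>, shared equally among the \<open>n choose k\<close> sets of \<open>k\<close>
  slots.
\<close>

definition log_weight :: "nat \<Rightarrow> nat \<Rightarrow> 'k"
  where "log_weight n k = (if k = 0 then 0 else (-1) ^ (k - 1) * of_nat (fact (k - 1) * fact (n - k)) / of_nat (fact n))"

text \<open>
  The value at \<open>(1 + x, \<dots>, 1 + x)\<close> is \<open>\<Sum>k=1..n. (-1)^(k-1) x^k / k\<close> if \<open>x\<close> has positive degree.
\<close>

definition log_form :: "nat \<Rightarrow> 'a list \<Rightarrow> 'a"
  where "log_form n u = (\<Sum>S\<in>Pow {..<n}. scale (log_weight n (card S)) (slot_product n S u))"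

lemma slot_product_update:
  assumes "length u = n" "i < n"
  shows "slot_product n S (u[i := x]) =
    (if i \<in> S then x - component 0 x else component 0 x) *
    (\<Prod>j\<in>{..<n} - {i}. if j \<in> S then u ! j - component 0 (u ! j) else component 0 (u ! j))"
proof -
  have "slot_product n S (u[i := x]) =
      (if i \<in> S then u[i := x] ! i - component 0 (u[i := x] ! i) else component 0 (u[i := x] ! i)) *
      (\<Prod>j\<in>{..<n} - {i}. if j \<in> S then u[i := x] ! j - component 0 (u[i := x] ! j)
        else component 0 (u[i := x] ! j))"
    unfolding slot_product_def using assms by (intro prod.remove) auto
  also have "(\<Prod>j\<in>{..<n} - {i}. if j \<in> S then u[i := x] ! j - component 0 (u[i := x] ! j)
        else component 0 (u[i := x] ! j)) =
      (\<Prod>j\<in>{..<n} - {i}. if j \<in> S then u ! j - component 0 (u ! j) else component 0 (u ! j))"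
    by (intro prod.cong refl) auto
  finally show ?thesis using assms by simp
qed

lemma slot_product_add:
  "length u = n \<Longrightarrow> i < n \<Longrightarrow>
    slot_product n S (u[i := x + y]) = slot_product n S (u[i := x]) + slot_product n S (u[i := y])"
  by (simp add: slot_product_update component_add algebra_simps)

lemma slot_product_scale:
  "length u = n \<Longrightarrow> i < n \<Longrightarrow>
    slot_product n S (u[i := scale c x]) = scale c (slot_product n S (u[i := x]))"
  by (simp add: slot_product_update component_scale scale_mult_left flip: scale_right_diff_distrib)

lemma slot_product_permute:
  assumes p: "p permutes {..<n}" and u: "length u = n"
  shows "slot_product n S (permute_list p u) = slot_product n (p ` S) u"
proof -
  have "slot_product n S (permute_list p u) =
      (\<Prod>i<n. if p i \<in> p ` S then u ! p i - component 0 (u ! p i) else component 0 (u ! p i))"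
    unfolding slot_product_def using p u
    by (intro prod.cong refl) (auto simp: permute_list_nth inj_image_mem_iff[OF permutes_inj[OF p]])
  also have "\<dots> = slot_product n (p ` S) u"
    unfolding slot_product_def
    using prod.permute[OF p, of "\<lambda>i. if i \<in> p ` S then u ! i - component 0 (u ! i) else component 0 (u ! i)"]
    by (simp add: o_def)
  finally show ?thesis .
qed

lemma slot_product_positive:
  assumes "length u = n" "i < n" "i \<notin> S" "b \<in> A e" "0 < e"
  shows "slot_product n S (u[i := b * x]) = 0"
  using assms by (simp add: slot_product_update component_0_mult_positive)

lemma log_form_permute:
  assumes p: "p permutes {..<n}" and u: "length u = n"
  shows "log_form n (permute_list p u) = log_form n u"
proof -
  have "log_form n (permute_list p u) =
      (\<Sum>S\<in>Pow {..<n}. scale (log_weight n (card (p ` S))) (slot_product n (p ` S) u))"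
    unfolding log_form_def using permutes_inj[OF p]
    by (intro sum.cong refl)
      (simp add: slot_product_permute[OF p u] card_image[OF inj_on_subset[OF _ subset_UNIV]])
  also have "\<dots> = log_form n u"
    unfolding log_form_def
  proof (intro sum.reindex_bij_betw[of "(`) p"])
    show "bij_betw ((`) p) (Pow {..<n}) (Pow {..<n})"
      using permutes_imp_bij[OF p] by (rule bij_betw_Pow)
  qed
  finally show ?thesis .
qed

lemma log_weight_Suc:
  assumes "0 < k" "k < n"
  shows "of_nat k * log_weight n k + of_nat (n - k) * log_weight n (Suc k) = 0"
proof -
  obtain j where k: "k = Suc j" using assms by (cases k) auto
  obtain m where m: "n - k = Suc m" using assms by (cases "n - k") auto
  then have "n - Suc k = m" by simp
  with k m show ?thesis by (simp add: log_weight_def algebra_simps add_divide_distrib[symmetric])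
qed

lemma log_weight_1:
  assumes "0 < n" "of_nat (fact n) \<noteq> (0::'k)"
  shows "of_nat n * log_weight n (Suc 0) = 1"
  using assms by (cases n) (simp_all add: log_weight_def algebra_simps)

text \<open>
  Pairs of a set and an element of it correspond to pairs of a set and an element outside of it.
\<close>

lemma sum_subsets_remove:
  "(\<Sum>S\<in>Pow {..<n}. \<Sum>j\<in>S. g (card S) (S - {j}))
    = (\<Sum>S\<in>Pow {..<n::nat}. \<Sum>j\<in>{..<n} - S. g (Suc (card S)) S)"
proof -
  have fin: "finite S" if "S \<subseteq> {..<n}" for S
    using that finite_subset by blast
  have pos: "Suc (card S - Suc 0) = card S" if "S \<subseteq> {..<n}" "j \<in> S" for S j
    using card_Suc_Diff1[of S j] that fin[of S] by simp
  have "(\<Sum>S\<in>Pow {..<n}. \<Sum>j\<in>S. g (card S) (S - {j})) =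
      (\<Sum>(S, j)\<in>(SIGMA S:Pow {..<n}. S). g (card S) (S - {j}))"
    by (rule sum.Sigma) (auto simp: fin)
  also have "\<dots> = (\<Sum>(S, j)\<in>(SIGMA S:Pow {..<n}. {..<n} - S). g (Suc (card S)) S)"
    by (rule sum.reindex_bij_witness[of _ "\<lambda>(S, j). (insert j S, j)" "\<lambda>(S, j). (S - {j}, j)"])
      (auto simp: pos insert_absorb fin)
  also have "\<dots> = (\<Sum>S\<in>Pow {..<n}. \<Sum>j\<in>{..<n} - S. g (Suc (card S)) S)"
    by (rule sum.Sigma[symmetric]) (auto simp: fin)
  finally show ?thesis .
qed

lemma of_nat_mult_eq_scale: "of_nat k * x = scale (of_nat k) x"
  by (induction k) (simp_all add: distrib_right scale_left_distrib)

text \<open>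
  Multiplying slot \<open>j\<close> by \<open>b\<close> leaves only the sets \<open>S\<close> containing \<open>j\<close>, and the new slot is \<open>b\<close> times the
  sum of both projections of the old one.  Hence the projection pattern of a \<open>k\<close>-element set arises
  \<open>k\<close> times from slots inside the set, with weight for \<open>k\<close>, and \<open>n - k\<close> times from slots outside, with
  weight for \<open>k + 1\<close>.  These contributions cancel unless one of the two kinds of slots is missing,
  which happens for the empty set and for the full set.
\<close>

lemma log_form_mult_slots:
  assumes n: "0 < n" "of_nat (fact n) \<noteq> (0::'k)" and u: "length u = n" and b: "b \<in> A e" "0 < e"
  shows "(\<Sum>j<n. log_form n (u[j := b * u ! j])) =
    b * (slot_product n {} u + scale (of_nat n * log_weight n n) (slot_product n {..<n} u))"
proof -
  let ?t = "\<lambda>S. slot_product n S u" and ?w = "log_weight n"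
  have upd: "slot_product n S (u[j := b * u ! j]) = (if j \<in> S then b * (?t S + ?t (S - {j})) else 0)"
    if j: "j < n" for j S
  proof (cases "j \<in> S")
    case True
    have t: "?t S' = (if j \<in> S' then u ! j - component 0 (u ! j) else component 0 (u ! j)) *
      (\<Prod>i\<in>{..<n} - {j}. if i \<in> S' then u ! i - component 0 (u ! i) else component 0 (u ! i))" for S'
      using slot_product_update[OF u j, of S' "u ! j"] by simp
    have "(\<Prod>i\<in>{..<n} - {j}. if i \<in> S - {j} then u ! i - component 0 (u ! i) else component 0 (u ! i))
        = (\<Prod>i\<in>{..<n} - {j}. if i \<in> S then u ! i - component 0 (u ! i) else component 0 (u ! i))"
      by (intro prod.cong refl) auto
    then have "?t S + ?t (S - {j}) = u ! j *
      (\<Prod>i\<in>{..<n} - {j}. if i \<in> S then u ! i - component 0 (u ! i) else component 0 (u ! i))"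
      using True by (simp add: t[of S] t[of "S - {j}"] algebra_simps)
    then show ?thesis
      using True slot_product_update[OF u j, of S "b * u ! j"]
      by (simp add: component_0_mult_positive[OF b] mult.assoc)
  qed (use slot_product_positive[OF u j _ b] in auto)
  have fin: "finite S" if "S \<subseteq> {..<n}" for S
    using that finite_subset by blast
  have "(\<Sum>j<n. log_form n (u[j := b * u ! j])) =
      (\<Sum>S\<in>Pow {..<n}. \<Sum>j<n. scale (?w (card S)) (slot_product n S (u[j := b * u ! j])))"
    unfolding log_form_def by (rule sum.swap)
  also have "\<dots> = (\<Sum>S\<in>Pow {..<n}. \<Sum>j<n. if j \<in> S then scale (?w (card S)) (b * (?t S + ?t (S - {j}))) else 0)"
    by (intro sum.cong refl) (auto simp: upd)
  also have "\<dots> = (\<Sum>S\<in>Pow {..<n}. \<Sum>j\<in>S. scale (?w (card S)) (b * (?t S + ?t (S - {j}))))"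
    by (intro sum.cong refl sum.mono_neutral_cong_right) auto
  also have "\<dots> = (\<Sum>S\<in>Pow {..<n}. \<Sum>j\<in>S. scale (?w (card S)) (b * ?t S)) +
      (\<Sum>S\<in>Pow {..<n}. \<Sum>j\<in>S. scale (?w (card S)) (b * ?t (S - {j})))"
    by (simp add: distrib_left scale_right_distrib sum.distrib)
  also have "(\<Sum>S\<in>Pow {..<n}. \<Sum>j\<in>S. scale (?w (card S)) (b * ?t (S - {j}))) =
      (\<Sum>S\<in>Pow {..<n}. \<Sum>j\<in>{..<n} - S. scale (?w (Suc (card S))) (b * ?t S))"
    by (rule sum_subsets_remove[of "\<lambda>k S. scale (?w k) (b * ?t S)"])
  also have "(\<Sum>S\<in>Pow {..<n}. \<Sum>j\<in>S. scale (?w (card S)) (b * ?t S)) + \<dots> =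
      (\<Sum>S\<in>Pow {..<n}. scale (of_nat (card S) * ?w (card S) + of_nat (n - card S) * ?w (Suc (card S))) (b * ?t S))"
    unfolding sum.distrib[symmetric]
    by (intro sum.cong refl) (auto simp: of_nat_mult_eq_scale card_Diff_subset fin scale_left_distrib)
  also have "\<dots> = (\<Sum>S\<in>Pow {..<n}. (if S = {} then b * ?t {} else 0) +
      (if S = {..<n} then scale (of_nat n * ?w n) (b * ?t {..<n}) else 0))"
  proof (intro sum.cong refl)
    fix S assume S: "S \<in> Pow {..<n}"
    show "scale (of_nat (card S) * ?w (card S) + of_nat (n - card S) * ?w (Suc (card S))) (b * ?t S) =
      (if S = {} then b * ?t {} else 0) +
      (if S = {..<n} then scale (of_nat n * ?w n) (b * ?t {..<n}) else 0)"
    proof (cases "S = {} \<or> S = {..<n}")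
      case True
      with n show ?thesis by (auto simp: log_weight_1)
    next
      case False
      with S have "0 < card S" "card S < n"
        using psubset_card_mono[of "{..<n}" S] fin[of S] by (auto simp: card_gt_0_iff)
      with False log_weight_Suc[OF this] show ?thesis by simp
    qed
  qed
  also have "\<dots> = b * ?t {} + scale (of_nat n * ?w n) (b * ?t {..<n})"
    by (simp add: sum.distrib)
  finally show ?thesis by (simp add: distrib_left scale_mult_right)
qed

definition log_map :: "nat \<Rightarrow> ('a list \<Rightarrow>\<^sub>0 'k) \<Rightarrow> 'a"
  where "log_map n = linear_extension scale (log_form n)"

text \<open>
  The algebra homomorphism to the base field that kills positive degrees, with values in \<open>K \<cdot> 1\<close>.
\<close>

definition augmentation :: "nat \<Rightarrow> ('a list \<Rightarrow>\<^sub>0 'k) \<Rightarrow> 'a"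
  where "augmentation n = linear_extension scale (slot_product n {})"

lemma linear_log_map: "Vector_Spaces.linear free_smult scale (log_map n)"
  unfolding log_map_def by (rule linear_linear_extension) (rule vector_space_axioms)

lemma linear_augmentation: "Vector_Spaces.linear free_smult scale (augmentation n)"
  unfolding augmentation_def by (rule linear_linear_extension) (rule vector_space_axioms)

lemma log_map_tuple [simp]: "log_map n (tuple u) = log_form n u"
  by (simp add: log_map_def linear_extension_single[OF vector_space_axioms])

lemma augmentation_tuple [simp]: "augmentation n (tuple u) = slot_product n {} u"
  by (simp add: augmentation_def linear_extension_single[OF vector_space_axioms])

lemma log_map_tensor_rel:
  assumes "r \<in> tensor_rel scale n"
  shows "log_map n r = 0"
proof -
  have "log_map n r \<in> {0}"
    by (rule linear_tensor_rel_into_subspace[OF linear_log_map subspace_single_0 _ _ assms])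
      (simp_all add: log_form_def slot_product_add slot_product_scale scale_right_distrib
        sum.distrib scale_sum_right mult.commute)
  then show ?thesis by simp
qed

lemma augmentation_tensor_rel:
  assumes "r \<in> tensor_rel scale n"
  shows "augmentation n r = 0"
proof -
  have "augmentation n r \<in> {0}"
    by (rule linear_tensor_rel_into_subspace[OF linear_augmentation subspace_single_0 _ _ assms])
      (simp_all add: slot_product_add slot_product_scale)
  then show ?thesis by simp
qed

definition bracket_lift :: "nat \<Rightarrow> 'a \<Rightarrow> ('a list \<Rightarrow>\<^sub>0 'k)"
  where "bracket_lift n b = (\<Sum>i<n. tuple ((replicate n 1)[i := b]))"

lemma bracket_lift_mult_tuple:
  assumes "length u = n"
  shows "free_mult (bracket_lift n b) (tuple u) = (\<Sum>i<n. tuple (u[i := b * u ! i]))"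
  unfolding bracket_lift_def free_mult_sum_left free_mult_single
proof (intro sum.cong refl)
  fix i assume "i \<in> {..<n}"
  then have "map2 (*) ((replicate n 1)[i := b]) u = u[i := b * u ! i]"
    using assms by (intro nth_equalityI) (auto simp: nth_list_update)
  then show "Poly_Mapping.single (map2 (*) ((replicate n 1)[i := b]) u) (1 * 1) = tuple (u[i := b * u ! i])"
    by simp
qed

end

section \<open>The grading of the tensor power\<close>

lemma finite_lists_sum:
  "finite {ds :: nat list. length ds = n \<and> sum_list ds = d}"
proof (rule finite_subset)
  show "{ds. length ds = n \<and> sum_list ds = d} \<subseteq> {ds. set ds \<subseteq> {..d} \<and> length ds = n}"
    using member_le_sum_list by force
qed (simp add: finite_lists_length_eq)

lemma sum_list_map2_add:
  "length ds = length es \<Longrightarrow> sum_list (map2 (+) ds es) = sum_list ds + sum_list (es :: nat list)"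
  by (induction ds es rule: list_induct2) auto

context connected_graded_algebra
begin

context
  fixes n :: nat
begin

abbreviation rels :: "('a list \<Rightarrow>\<^sub>0 'k) set"
  where "rels \<equiv> tensor_rel scale n"

lemma subspace_rels: "free_space.subspace rels"
  by (simp add: tensor_rel_def)

lemmas rels_zero = free_space.subspace_0[OF subspace_rels]
lemmas rels_add = free_space.subspace_add[OF subspace_rels]
lemmas rels_diff = free_space.subspace_diff[OF subspace_rels]
lemmas rels_scale = free_space.subspace_scale[OF subspace_rels]
lemmas rels_sum = free_space.subspace_sum[OF subspace_rels]

lemma tensor_class_eq_iff:
  "tensor_class scale n f = tensor_class scale n g \<longleftrightarrow> f - g \<in> rels"
proof
  assume "tensor_class scale n f = tensor_class scale n g"
  moreover have "f \<in> tensor_class scale n f"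
    using rels_zero by (force simp: tensor_class_eq)
  ultimately obtain r where "r \<in> rels" "f = r + g" by (auto simp: tensor_class_eq)
  then show "f - g \<in> rels" by simp
next
  assume fg: "f - g \<in> rels"
  have "r + f \<in> (\<lambda>r. r + g) ` rels" "r + g \<in> (\<lambda>r. r + f) ` rels" if "r \<in> rels" for r
    using rels_add[OF that fg] rels_diff[OF that fg]
    by (auto intro: image_eqI[of _ _ "r + (f - g)"] image_eqI[of _ _ "r - (f - g)"])
  then show "tensor_class scale n f = tensor_class scale n g"
    by (auto simp: tensor_class_eq)
qed

lemma carrier_add: "f \<in> carrier (free_algebra n) \<Longrightarrow> g \<in> carrier (free_algebra n) \<Longrightarrow>
    f + g \<in> carrier (free_algebra n)"
  using Poly_Mapping.keys_add[of f g] by (auto simp: free_algebra_simps)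

lemma rels_mult_right: "f \<in> carrier (free_algebra n) \<Longrightarrow> r \<in> rels \<Longrightarrow> free_mult f r \<in> rels"
  by (rule free_mult_tensor_rel)

lemma rels_mult_left: "f \<in> carrier (free_algebra n) \<Longrightarrow> r \<in> rels \<Longrightarrow> free_mult r f \<in> rels"
  by (subst free_mult_commute) (rule free_mult_tensor_rel)

lemma rels_mult_cong:
  assumes "f - f' \<in> rels" "g - g' \<in> rels" "f \<in> carrier (free_algebra n)" "g' \<in> carrier (free_algebra n)"
  shows "free_mult f g - free_mult f' g' \<in> rels"
proof -
  have "free_mult f g - free_mult f' g' = free_mult f (g - g') + free_mult (f - f') g'"
    using free_mult_add_left[of "f - f'" f' g'] by (simp add: free_mult_diff_right)
  then show ?thesis
    using rels_add[OF rels_mult_right[OF assms(3,2)] rels_mult_left[OF assms(4,1)]] by simp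
qed

lemma zero_slot_in_rels:
  assumes "length u = n" "i < n" "u ! i = 0"
  shows "tuple u \<in> rels"
proof -
  have "tuple (u[i := scale 0 0]) - Poly_Mapping.single (u[i := 0]) 0 \<in> multilinear_rels scale n"
    by (rule multilinear_rels.scale) (use assms in auto)
  then have "tuple (u[i := 0]) \<in> rels"
    by (simp add: tensor_rel_def free_space.span_base)
  then show ?thesis using assms(3) by (metis list_update_id)
qed

lemma slot_sum_in_rels:
  assumes "length u = n" "i < n" "finite D"
  shows "tuple (u[i := \<Sum>d\<in>D. x d]) - (\<Sum>d\<in>D. tuple (u[i := x d])) \<in> rels"
  using assms(3)
proof (induction D rule: finite_induct)
  case empty
  then show ?case using assms by (simp add: zero_slot_in_rels)
next
  case (insert d D)
  have "tuple (u[i := x d + (\<Sum>d\<in>D. x d)]) - tuple (u[i := x d]) - tuple (u[i := \<Sum>d\<in>D. x d]) \<in> rels"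
    unfolding tensor_rel_def using assms
    by (intro free_space.span_base multilinear_rels.add) auto
  from rels_add[OF this insert.IH] show ?case
    using insert.hyps by (simp add: algebra_simps)
qed

subsection \<open>Homogeneous and invariant representatives\<close>

definition homogeneous_tuples :: "nat \<Rightarrow> 'a list set"
  where "homogeneous_tuples d =
    {u. \<exists>ds. length u = n \<and> length ds = n \<and> sum_list ds = d \<and> (\<forall>i<n. u ! i \<in> A (ds ! i))}"

definition homogeneous_space :: "nat \<Rightarrow> ('a list \<Rightarrow>\<^sub>0 'k) set"
  where "homogeneous_space d = {f. Poly_Mapping.keys f \<subseteq> homogeneous_tuples d}"

text \<open>
  The lifts are the full preimages in the free space: of the homogeneous component of degree \<open>d\<close> of
  the tensor power, of the invariants, and of the homogeneous component of the invariants.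
\<close>

definition tensor_lift :: "nat \<Rightarrow> ('a list \<Rightarrow>\<^sub>0 'k) set"
  where "tensor_lift d = {f. \<exists>h\<in>homogeneous_space d. f - h \<in> rels}"

definition invariant_lift :: "('a list \<Rightarrow>\<^sub>0 'k) set"
  where "invariant_lift =
    {f \<in> carrier (free_algebra n). \<forall>p. p permutes {..<n} \<longrightarrow> free_permute p f - f \<in> rels}"

definition sym_lift :: "nat \<Rightarrow> ('a list \<Rightarrow>\<^sub>0 'k) set"
  where "sym_lift d = tensor_lift d \<inter> invariant_lift"

lemma subspace_carrier: "free_space.subspace (carrier (free_algebra n :: ('a list \<Rightarrow>\<^sub>0 'k) ring))"
  by (rule free_space.subspaceI) (auto simp: carrier_add, auto simp: free_algebra_simps in_keys_iff)

lemma subspace_homogeneous_space: "free_space.subspace (homogeneous_space d)"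
proof (rule free_space.subspaceI)
  fix f g assume "f \<in> homogeneous_space d" "g \<in> homogeneous_space d"
  then show "f + g \<in> homogeneous_space d"
    using Poly_Mapping.keys_add[of f g] by (auto simp: homogeneous_space_def)
next
  fix c f assume "f \<in> homogeneous_space d"
  then show "free_smult c f \<in> homogeneous_space d"
    by (auto simp: homogeneous_space_def in_keys_iff)
qed (simp add: homogeneous_space_def)

lemma homogeneous_tuples_length: "u \<in> homogeneous_tuples d \<Longrightarrow> length u = n"
  by (auto simp: homogeneous_tuples_def)

lemma homogeneous_space_closed: "f \<in> homogeneous_space d \<Longrightarrow> f \<in> carrier (free_algebra n)"
  by (auto simp: homogeneous_space_def free_algebra_simps homogeneous_tuples_length)

lemma homogeneous_space_subset_lift: "homogeneous_space d \<subseteq> tensor_lift d"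
  using rels_zero by (force simp: tensor_lift_def)

lemma rels_subset_tensor_lift: "rels \<subseteq> tensor_lift d"
  using free_space.subspace_0[OF subspace_homogeneous_space] by (force simp: tensor_lift_def)

lemma subspace_tensor_lift: "free_space.subspace (tensor_lift d)"
proof (rule free_space.subspaceI)
  show "0 \<in> tensor_lift d" using rels_subset_tensor_lift rels_zero by auto
next
  fix f g assume "f \<in> tensor_lift d" "g \<in> tensor_lift d"
  then obtain h k where "h \<in> homogeneous_space d" "f - h \<in> rels" "k \<in> homogeneous_space d" "g - k \<in> rels"
    by (auto simp: tensor_lift_def)
  then have "h + k \<in> homogeneous_space d" "(f + g) - (h + k) \<in> rels"
    using rels_add[of "f - h" "g - k"] free_space.subspace_add[OF subspace_homogeneous_space]
    by (auto simp: algebra_simps)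
  then show "f + g \<in> tensor_lift d" by (auto simp: tensor_lift_def)
next
  fix c f assume "f \<in> tensor_lift d"
  then obtain h where "h \<in> homogeneous_space d" "f - h \<in> rels" by (auto simp: tensor_lift_def)
  then have "free_smult c h \<in> homogeneous_space d" "free_smult c f - free_smult c h \<in> rels"
    using rels_scale[of "f - h" c] free_space.subspace_scale[OF subspace_homogeneous_space]
    by (auto simp: free_space.scale_right_diff_distrib)
  then show "free_smult c f \<in> tensor_lift d" by (auto simp: tensor_lift_def)
qed

lemma tensor_lift_closed:
  assumes "f \<in> tensor_lift d"
  shows "f \<in> carrier (free_algebra n)"
proof -
  obtain h where "h \<in> homogeneous_space d" "f - h \<in> rels" using assms by (auto simp: tensor_lift_def)
  then show ?thesis
    using carrier_add[OF homogeneous_space_closed tensor_rel_closed, of h d "f - h"] by simp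
qed

lemma subspace_invariant_lift: "free_space.subspace invariant_lift"
proof -
  have "free_permute p (f + g) - (f + g) = (free_permute p f - f) + (free_permute p g - g)"
    "free_permute p (free_smult c f) - free_smult c f = free_smult c (free_permute p f - f)"
    for p c and f g :: "'a list \<Rightarrow>\<^sub>0 'k"
    by (simp_all add: free_permute_add free_permute_smult free_space.scale_right_diff_distrib)
  note permute = this
  show ?thesis
    using subspace_carrier subspace_rels unfolding invariant_lift_def
    by (intro free_space.subspaceI CollectI conjI allI impI)
      (auto simp only: permute mem_Collect_eq free_permute_0 diff_zero
        intro: free_space.subspace_0 free_space.subspace_add free_space.subspace_scale)
qed

lemma subspace_sym_lift: "free_space.subspace (sym_lift d)"
  unfolding sym_lift_def by (intro free_space.subspace_inter subspace_tensor_lift subspace_invariant_lift)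

lemma rels_subset_invariant_lift: "rels \<subseteq> invariant_lift"
proof
  fix r assume r: "r \<in> rels"
  then have "free_permute p r - r \<in> rels" if "p permutes {..<n}" for p
    using free_permute_tensor_rel[OF that] by (intro rels_diff) auto
  with r show "r \<in> invariant_lift" by (simp add: invariant_lift_def tensor_rel_closed)
qed

lemma rels_subset_sym_lift: "rels \<subseteq> sym_lift d"
  using rels_subset_tensor_lift rels_subset_invariant_lift by (auto simp: sym_lift_def)

lemma sym_lift_closed: "f \<in> sym_lift d \<Longrightarrow> f \<in> carrier (free_algebra n)"
  by (auto simp: sym_lift_def tensor_lift_closed)

lemma sym_lift_invariant: "f \<in> sym_lift d \<Longrightarrow> f \<in> invariant_lift"
  by (simp add: sym_lift_def)

lemma homogeneous_tuples_mult:
  assumes "u \<in> homogeneous_tuples d" "v \<in> homogeneous_tuples e"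
  shows "map2 (*) u v \<in> homogeneous_tuples (d + e)"
proof -
  obtain ds es where "length u = n" "length ds = n" "sum_list ds = d" "\<forall>i<n. u ! i \<in> A (ds ! i)"
    "length v = n" "length es = n" "sum_list es = e" "\<forall>i<n. v ! i \<in> A (es ! i)"
    using assms unfolding homogeneous_tuples_def by auto
  then show ?thesis
    unfolding homogeneous_tuples_def mem_Collect_eq
    by (intro exI[of _ "map2 (+) ds es"]) (simp add: sum_list_map2_add comp_mult)
qed

lemma homogeneous_space_mult:
  assumes "f \<in> homogeneous_space d" "g \<in> homogeneous_space e"
  shows "free_mult f g \<in> homogeneous_space (d + e)"
  using keys_free_mult[of f g] assms homogeneous_tuples_mult unfolding homogeneous_space_def by fastforce

lemma tensor_lift_mult:
  assumes f: "f \<in> tensor_lift d" and g: "g \<in> tensor_lift e"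
  shows "free_mult f g \<in> tensor_lift (d + e)"
proof -
  obtain h k where "h \<in> homogeneous_space d" "f - h \<in> rels" "k \<in> homogeneous_space e" "g - k \<in> rels"
    using assms by (auto simp: tensor_lift_def)
  then have "free_mult f g - free_mult h k \<in> rels" "free_mult h k \<in> homogeneous_space (d + e)"
    using tensor_lift_closed[OF f] by (auto intro: rels_mult_cong homogeneous_space_closed homogeneous_space_mult)
  then show ?thesis by (auto simp: tensor_lift_def)
qed

lemma invariant_lift_mult:
  assumes f: "f \<in> invariant_lift" and g: "g \<in> invariant_lift"
  shows "free_mult f g \<in> invariant_lift"
  using assms unfolding invariant_lift_def
  by (auto simp: free_mult_closed free_permute_mult intro!: rels_mult_cong free_permute_closed)

lemma sym_lift_mult:
  "f \<in> sym_lift d \<Longrightarrow> g \<in> sym_lift e \<Longrightarrow> free_mult f g \<in> sym_lift (d + e)"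
  by (simp add: sym_lift_def tensor_lift_mult invariant_lift_mult)

lemma carrier_sym_invariants_eq:
  "carrier (sym_invariants scale n) = tensor_class scale n ` invariant_lift"
proof (intro Set.set_eqI iffI)
  fix X assume "X \<in> carrier (sym_invariants scale n)"
  then obtain f where "f \<in> carrier (free_algebra n)" "X = tensor_class scale n f"
    "\<And>p. p permutes {..<n} \<Longrightarrow> tensor_class scale n (free_permute p f) = tensor_class scale n f"
    by (rule sym_invariantsE) blast
  then show "X \<in> tensor_class scale n ` invariant_lift"
    by (auto simp: invariant_lift_def tensor_class_eq_iff)
next
  fix X assume "X \<in> tensor_class scale n ` invariant_lift"
  then obtain f where "f \<in> invariant_lift" "X = tensor_class scale n f" by blast
  then show "X \<in> carrier (sym_invariants scale n)"
    by (simp add: invariant_lift_def tensor_class_eq_iff sym_invariantsI)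
qed

lemma invariant_lift_cong:
  assumes "f \<in> invariant_lift" "g - f \<in> rels"
  shows "g \<in> invariant_lift"
  using free_space.subspace_add[OF subspace_invariant_lift assms(1), of "g - f"]
    rels_subset_invariant_lift assms(2) by auto

lemma sym_comp_eq: "sym_comp scale A n d = tensor_class scale n ` sym_lift d"
proof (intro Set.set_eqI iffI)
  fix X assume "X \<in> sym_comp scale A n d"
  then obtain h f where "h \<in> homogeneous_space d" "X = tensor_class scale n h"
    "f \<in> invariant_lift" "X = tensor_class scale n f"
    unfolding sym_comp_def carrier_sym_invariants_eq tensor_comp_def
    by (auto simp: homogeneous_space_def homogeneous_tuples_def subset_eq)
  moreover from this have "h \<in> invariant_lift"
    by (metis invariant_lift_cong tensor_class_eq_iff)
  ultimately show "X \<in> tensor_class scale n ` sym_lift d"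
    using homogeneous_space_subset_lift by (auto simp: sym_lift_def)
next
  fix X assume "X \<in> tensor_class scale n ` sym_lift d"
  then obtain f h where f: "f \<in> invariant_lift" "X = tensor_class scale n f"
    "h \<in> homogeneous_space d" "f - h \<in> rels"
    by (auto simp: sym_lift_def tensor_lift_def)
  then have "X = tensor_class scale n h" by (simp add: tensor_class_eq_iff)
  with f have "X \<in> tensor_comp scale A n d"
    by (auto simp: tensor_comp_def homogeneous_space_def homogeneous_tuples_def subset_eq)
  with f show "X \<in> sym_comp scale A n d"
    by (simp add: sym_comp_def carrier_sym_invariants_eq)
qed

subsection \<open>Projection to a homogeneous component\<close>

text \<open>
  The multidegrees \<open>ds\<close> of total degree \<open>d\<close> are finite in number, so the projection is given on all
  tuples by one formula and need not refer to a decomposition of the tensor.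
\<close>

definition degree_part :: "nat \<Rightarrow> ('a list \<Rightarrow>\<^sub>0 'k) \<Rightarrow> ('a list \<Rightarrow>\<^sub>0 'k)"
  where "degree_part d = linear_extension free_smult
    (\<lambda>u. \<Sum>ds | length ds = n \<and> sum_list ds = d. tuple (map2 component ds u))"

lemma linear_degree_part: "Vector_Spaces.linear free_smult free_smult (degree_part d)"
  unfolding degree_part_def by (rule linear_linear_extension) (rule free_space.vector_space_axioms)

lemma degree_part_tuple:
  "degree_part d (tuple u) = (\<Sum>ds | length ds = n \<and> sum_list ds = d. tuple (map2 component ds u))"
  by (simp add: degree_part_def linear_extension_single[OF free_space.vector_space_axioms])

lemma map2_component_update:
  assumes "length u = n" "length ds = n" "i < n"
  shows "map2 component ds (u[i := x]) = (map2 component ds u)[i := component (ds ! i) x]"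
  using assms by (intro nth_equalityI) (auto simp: nth_list_update)

lemma degree_part_rels:
  assumes "r \<in> rels"
  shows "degree_part d r \<in> rels"
proof (rule linear_tensor_rel_into_subspace[OF linear_degree_part subspace_rels _ _ assms])
  fix u :: "'a list" and i x y assume u: "length u = n" "i < n"
  have "degree_part d (tuple (u[i := x + y])) - degree_part d (tuple (u[i := x])) - degree_part d (tuple (u[i := y]))
    = (\<Sum>ds | length ds = n \<and> sum_list ds = d.
        tuple ((map2 component ds u)[i := component (ds ! i) x + component (ds ! i) y])
        - tuple ((map2 component ds u)[i := component (ds ! i) x])
        - tuple ((map2 component ds u)[i := component (ds ! i) y]))"
    using u by (simp add: degree_part_tuple map2_component_update component_add sum_subtractf)
  also have "\<dots> \<in> rels"
    unfolding tensor_rel_def using u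
    by (intro free_space.span_sum free_space.span_base multilinear_rels.add) auto
  finally show "degree_part d (tuple (u[i := x + y])) - degree_part d (tuple (u[i := x])) - degree_part d (tuple (u[i := y])) \<in> rels" .
next
  fix u :: "'a list" and i x c assume u: "length u = n" "i < n"
  have "degree_part d (tuple (u[i := scale c x])) - free_smult c (degree_part d (tuple (u[i := x])))
    = (\<Sum>ds | length ds = n \<and> sum_list ds = d.
        tuple ((map2 component ds u)[i := scale c (component (ds ! i) x)])
        - Poly_Mapping.single ((map2 component ds u)[i := component (ds ! i) x]) c)"
    using u by (simp add: degree_part_tuple map2_component_update component_scale sum_subtractf
        free_space.scale_sum_right)
  also have "\<dots> \<in> rels"
    unfolding tensor_rel_def using u
    by (intro free_space.span_sum free_space.span_base multilinear_rels.scale) auto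
  finally show "degree_part d (tuple (u[i := scale c x])) - free_smult c (degree_part d (tuple (u[i := x]))) \<in> rels" .
qed

text \<open>
  Any multidegree other than that of \<open>u\<close> produces a tuple with a zero slot.
\<close>

lemma degree_part_homogeneous_tuple:
  assumes "u \<in> homogeneous_tuples e"
  shows "degree_part d (tuple u) - (if d = e then tuple u else 0) \<in> rels"
proof -
  obtain es where es: "length u = n" "length es = n" "sum_list es = e" "\<And>i. i < n \<Longrightarrow> u ! i \<in> A (es ! i)"
    using assms by (auto simp: homogeneous_tuples_def)
  let ?D = "{ds. length ds = n \<and> sum_list ds = d}"
  have other: "tuple (map2 component ds u) \<in> rels" if "length ds = n" "ds \<noteq> es" for ds
  proof -
    from that es(2) obtain i where "i < n" "ds ! i \<noteq> es ! i" by (auto simp: list_eq_iff_nth_eq)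
    then show ?thesis
      using es(1,2) that component_homogeneous[OF es(4)]
      by (intro zero_slot_in_rels[of _ i]) auto
  qed
  have same: "map2 component es u = u"
    using es(1,2) component_homogeneous[OF es(4)] by (intro nth_equalityI) auto
  have "degree_part d (tuple u) - (if d = e then tuple u else 0) =
      (\<Sum>ds\<in>?D - {es}. tuple (map2 component ds u))"
    using es by (auto simp: degree_part_tuple same sum.remove[OF finite_lists_sum, of es] finite_lists_sum)
  also have "\<dots> \<in> rels"
    by (rule rels_sum) (use other in blast)
  finally show ?thesis .
qed

text \<open>
  The projections separate the homogeneous components of the tensor power, so their sum is direct.
\<close>

lemma degree_part_of_homogeneous:
  assumes "f \<in> tensor_lift e"
  shows "degree_part d f - (if d = e then f else 0) \<in> rels"
proof -
  interpret L: Vector_Spaces.linear free_smult free_smult "degree_part d"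
    by (rule linear_degree_part)
  let ?M = "\<lambda>f. degree_part d f - (if d = e then f else 0)"
  have M: "Vector_Spaces.linear free_smult free_smult ?M"
    by (auto simp: Vector_Spaces.linear_iff free_space.vector_space_axioms L.add L.scale
        free_space.scale_right_diff_distrib)
  obtain h where h: "h \<in> homogeneous_space e" "f - h \<in> rels"
    using assms by (auto simp: tensor_lift_def)
  have "?M h \<in> rels"
  proof (rule linear_into_subspace[OF M subspace_rels])
    fix u assume "u \<in> Poly_Mapping.keys h"
    with h(1) show "?M (tuple u) \<in> rels"
      by (intro degree_part_homogeneous_tuple) (auto simp: homogeneous_space_def)
  qed
  moreover have "?M (f - h) \<in> rels"
    using degree_part_rels[OF h(2)] h(2) rels_diff by auto
  ultimately have "?M h + ?M (f - h) \<in> rels" by (rule rels_add)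
  then show ?thesis by (simp add: L.diff split: if_splits)
qed

lemma degree_part_in_tensor_lift:
  assumes "f \<in> carrier (free_algebra n)"
  shows "degree_part d f \<in> tensor_lift d"
proof -
  have "degree_part d f \<in> homogeneous_space d"
  proof (rule linear_into_subspace[OF linear_degree_part subspace_homogeneous_space])
    fix u assume "u \<in> Poly_Mapping.keys f"
    with assms have "length u = n" by (simp add: free_algebra_simps)
    then have "tuple (map2 component ds u) \<in> homogeneous_space d"
      if "length ds = n" "sum_list ds = d" for ds
      using that component_in by (auto simp: homogeneous_space_def homogeneous_tuples_def)
    then show "degree_part d (tuple u) \<in> homogeneous_space d"
      unfolding degree_part_tuple
      by (intro free_space.subspace_sum[OF subspace_homogeneous_space]) auto
  qed
  then show ?thesis using homogeneous_space_subset_lift by auto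
qed

lemma degree_part_permute:
  assumes p: "p permutes {..<n}" and f: "f \<in> carrier (free_algebra n)"
  shows "degree_part d (free_permute p f) = free_permute p (degree_part d f)"
proof -
  have "(degree_part d \<circ> free_permute p) f = (free_permute p \<circ> degree_part d) f"
  proof (rule linear_eq_on_carrier[OF _ _ f])
    show "Vector_Spaces.linear free_smult free_smult (degree_part d \<circ> free_permute p)"
      "Vector_Spaces.linear free_smult free_smult (free_permute p \<circ> degree_part d)"
      by (intro Vector_Spaces.linear_compose[of _ free_smult] linear_degree_part linear_free_permute)+
    fix u :: "'a list" assume u: "length u = n"
    let ?D = "{ds. length ds = n \<and> sum_list ds = d}"
    have bij: "bij_betw (permute_list p) ?D ?D"
    proof (rule bij_betw_byWitness[of _ "permute_list (inv_into UNIV p)"])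
      have inv: "inv_into UNIV p permutes {..<n}" using p by (rule permutes_inv)
      show "\<forall>ds\<in>?D. permute_list (inv_into UNIV p) (permute_list p ds) = ds"
        "\<forall>ds\<in>?D. permute_list p (permute_list (inv_into UNIV p) ds) = ds"
        using p inv by (auto simp: permutes_inv_o simp flip: permute_list_compose)
      show "permute_list p ` ?D \<subseteq> ?D" "permute_list (inv_into UNIV p) ` ?D \<subseteq> ?D"
        using p inv mset_permute_list by (auto simp flip: sum_mset_sum_list)
    qed
    have "(\<Sum>ds\<in>?D. tuple (map2 component ds (permute_list p u))) =
        (\<Sum>ds\<in>?D. tuple (map2 component (permute_list p ds) (permute_list p u)) :: 'a list \<Rightarrow>\<^sub>0 'k)"
      by (rule sum.reindex_bij_betw[OF bij, symmetric])
    also have "\<dots> = (\<Sum>ds\<in>?D. tuple (permute_list p (map2 component ds u)))"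
      using p u by (intro sum.cong refl) (simp add: permute_list_map permute_list_zip)
    finally show "(degree_part d \<circ> free_permute p) (tuple u) = (free_permute p \<circ> degree_part d) (tuple u)"
      by (simp add: degree_part_tuple free_permute_sum)
  qed
  then show ?thesis by simp
qed

lemma degree_part_invariant:
  assumes "f \<in> invariant_lift"
  shows "degree_part d f \<in> sym_lift d"
proof -
  interpret L: Vector_Spaces.linear free_smult free_smult "degree_part d"
    by (rule linear_degree_part)
  have f: "f \<in> carrier (free_algebra n)" using assms by (simp add: invariant_lift_def)
  then have "degree_part d f \<in> tensor_lift d" by (rule degree_part_in_tensor_lift)
  moreover have "free_permute p (degree_part d f) - degree_part d f \<in> rels" if "p permutes {..<n}" for p
    using degree_part_rels[of "free_permute p f - f" d] that assms
    by (simp add: invariant_lift_def L.diff degree_part_permute[OF that f])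
  ultimately show ?thesis
    by (simp add: sym_lift_def invariant_lift_def tensor_lift_closed)
qed

text \<open>
  The slots are split into homogeneous components one after the other; \<open>k\<close> counts those that have not
  been treated yet.
\<close>

lemma carrier_subset_span_homogeneous:
  assumes "f \<in> carrier (free_algebra n)"
  shows "f \<in> free_space.span (tuple ` (\<Union>d. homogeneous_tuples d) \<union> rels)"
proof -
  let ?H = "free_space.span (tuple ` (\<Union>d. homogeneous_tuples d) \<union> rels)"
  have rels: "r \<in> ?H" if "r \<in> rels" for r using that by (auto intro: free_space.span_base)
  have tuple: "tuple u \<in> ?H"
    if "length u = n" "k \<le> n" "\<And>i. k \<le> i \<Longrightarrow> i < n \<Longrightarrow> \<exists>d. u ! i \<in> A d" for u k
    using that
  proof (induction k arbitrary: u)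
    case 0
    then obtain d where "\<And>i. i < n \<Longrightarrow> u ! i \<in> A (d i)" by (metis le0)
    with 0 have "u \<in> homogeneous_tuples (sum_list (map d [0..<n]))"
      by (auto simp: homogeneous_tuples_def intro!: exI[of _ "map d [0..<n]"])
    then show ?case by (auto intro: free_space.span_base)
  next
    case (Suc k)
    let ?D = "{d. component d (u ! k) \<noteq> 0}"
    have "tuple (u[k := component d (u ! k)]) \<in> ?H" for d
    proof (rule Suc.IH)
      fix i assume "k \<le> i" "i < n"
      then show "\<exists>e. u[k := component d (u ! k)] ! i \<in> A e"
        using Suc.prems(1) Suc.prems(3)[of i] component_in by (cases "i = k") auto
    qed (use Suc.prems in auto)
    moreover have "tuple (u[k := \<Sum>d\<in>?D. component d (u ! k)]) - (\<Sum>d\<in>?D. tuple (u[k := component d (u ! k)])) \<in> ?H"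
      using Suc.prems by (intro rels slot_sum_in_rels finite_components) auto
    ultimately have "tuple (u[k := \<Sum>d\<in>?D. component d (u ! k)]) - (\<Sum>d\<in>?D. tuple (u[k := component d (u ! k)]))
        + (\<Sum>d\<in>?D. tuple (u[k := component d (u ! k)])) \<in> ?H"
      by (intro free_space.span_add free_space.span_sum)
    then show ?case by (simp add: sum_components)
  qed
  have "id f \<in> ?H"
    by (rule linear_into_subspace[OF free_space.linear_id free_space.subspace_span])
      (use assms tuple[of _ n] in \<open>auto simp: free_algebra_simps\<close>)
  then show ?thesis by simp
qed

lemma sum_degree_parts:
  assumes "f \<in> carrier (free_algebra n)"
  shows "\<exists>D. f - (\<Sum>d<D. degree_part d f) \<in> rels"
proof -
  interpret L: Vector_Spaces.linear free_smult free_smult "degree_part d" for d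
    by (rule linear_degree_part)
  let ?E = "\<lambda>D f. f - (\<Sum>d<D. degree_part d f)"
  \<comment> \<open>Summands need different bounds; a statement for all large bounds is closed under addition.\<close>
  have "\<exists>D0. \<forall>D\<ge>D0. ?E D f \<in> rels"
    using carrier_subset_span_homogeneous[OF assms]
  proof (induction rule: free_space.span_induct_alt)
    case base
    then show ?case by (simp add: L.zero rels_zero)
  next
    case (step c x y)
    have "\<exists>D1. \<forall>D\<ge>D1. ?E D x \<in> rels"
    proof (cases "x \<in> rels")
      case True
      then have "?E D x \<in> rels" for D by (intro rels_diff rels_sum degree_part_rels)
      then show ?thesis by simp
    next
      case False
      with step(1) obtain u e where x: "x = tuple u" "u \<in> homogeneous_tuples e" by auto
      have "?E D x \<in> rels" if "e < D" for D
      proof -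
        have "?E D x = - (\<Sum>d<D. degree_part d x - (if d = e then x else 0))"
          using that by (simp add: sum_subtractf)
        also have "\<dots> \<in> rels"
          unfolding x(1) using x(2)
          by (intro free_space.subspace_neg[OF subspace_rels] rels_sum degree_part_homogeneous_tuple)
        finally show ?thesis .
      qed
      then show ?thesis by (auto intro: exI[of _ "Suc e"])
    qed
    then obtain D1 where D1: "\<And>D. D \<ge> D1 \<Longrightarrow> ?E D x \<in> rels" by auto
    obtain D2 where D2: "\<And>D. D \<ge> D2 \<Longrightarrow> ?E D y \<in> rels" using step(2) by auto
    have "?E D (free_smult c x + y) \<in> rels" if "D \<ge> max D1 D2" for D
    proof -
      have "?E D (free_smult c x + y) = free_smult c (?E D x) + ?E D y"
        by (simp add: L.add L.scale sum.distrib free_space.scale_right_diff_distrib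
            free_space.scale_sum_right)
      also have "\<dots> \<in> rels"
        using that by (intro rels_add rels_scale D1 D2) auto
      finally show ?thesis .
    qed
    then show ?case by blast
  qed
  then show ?thesis by blast
qed

subsection \<open>The augmentation vanishes in positive degree\<close>

lemma augmentation_one: "augmentation n (tuple (replicate n 1)) = 1"
  by (simp add: slot_product_def component_homogeneous[OF one_in_A0])

lemma augmentation_mult_positive:
  assumes f: "f \<in> carrier (free_algebra n)" and g: "g \<in> tensor_lift e" and e: "0 < e"
  shows "augmentation n (free_mult f g) = 0"
proof -
  interpret L: Vector_Spaces.linear free_smult scale "augmentation n" by (rule linear_augmentation)
  obtain h where h: "h \<in> homogeneous_space e" "g - h \<in> rels"
    using g by (auto simp: tensor_lift_def)
  have tuples: "augmentation n (free_mult (tuple u) (tuple v)) = 0"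
    if u: "length u = n" and v: "v \<in> homogeneous_tuples e" for u v
  proof -
    obtain ds where ds: "length v = n" "length ds = n" "sum_list ds = e" "\<And>i. i < n \<Longrightarrow> v ! i \<in> A (ds ! i)"
      using v by (auto simp: homogeneous_tuples_def)
    with e obtain i where i: "i < n" "0 < ds ! i" by (metis gr0I in_set_conv_nth sum_list_eq_0_iff)
    then have "component 0 (v ! i * u ! i) = 0" using ds by (intro component_0_mult_positive)
    then show ?thesis
      unfolding augmentation_tuple slot_product_def free_mult_single mult_1_right
      using i u ds(1) by (intro prod_zero) (auto simp: mult.commute intro!: bexI[of _ i])
  qed
  have "(augmentation n \<circ> (\<lambda>f. free_mult f h)) f \<in> {0}"
  proof (rule linear_into_subspace[OF Vector_Spaces.linear_compose[OF linear_free_mult_left linear_augmentation]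
        subspace_single_0])
    fix u assume "u \<in> Poly_Mapping.keys f"
    then have u: "length u = n" using f by (simp add: free_algebra_simps)
    have "(augmentation n \<circ> free_mult (tuple u)) h \<in> {0}"
      by (rule linear_into_subspace[OF Vector_Spaces.linear_compose[OF linear_free_mult_right linear_augmentation]
        subspace_single_0]) (use h(1) tuples[OF u] in \<open>auto simp: homogeneous_space_def\<close>)
    then show "(augmentation n \<circ> (\<lambda>f. free_mult f h)) (tuple u) \<in> {0}" by simp
  qed
  moreover have "augmentation n (free_mult f (g - h)) = 0"
    by (rule augmentation_tensor_rel) (rule rels_mult_right[OF f h(2)])
  ultimately show ?thesis by (simp add: free_mult_diff_right L.diff)
qed

end
end

section \<open>The logarithm kills decomposable invariants\<close>

text \<open>
  The positive degrees that occur in the algebra are at least \<open>q\<close>, and \<open>n!\<close> is invertible.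
\<close>

locale sparse_graded_algebra = connected_graded_algebra scale A
  for scale :: "'k::field \<Rightarrow> 'a::comm_ring_1 \<Rightarrow> 'a" and A :: "nat \<Rightarrow> 'a set" +
  fixes n q :: nat
  assumes n_pos: "0 < n"
    and char_large: "CHAR('k) = 0 \<or> CHAR('k) > n"
    and gap: "\<And>d. 0 < d \<Longrightarrow> d < q \<Longrightarrow> A d = {0}"
begin

lemma of_nat_nonzero:
  assumes "0 < m" "m \<le> n"
  shows "of_nat m \<noteq> (0::'k)"
proof
  assume "of_nat m = (0::'k)"
  then have "CHAR('k) dvd m" by (simp add: of_nat_eq_0_iff_char_dvd)
  with assms char_large show False by (auto dest: dvd_imp_le)
qed

lemma of_nat_fact_nonzero: "of_nat (fact n) \<noteq> (0::'k)"
proof -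
  have "of_nat (fact m) \<noteq> (0::'k)" if "m \<le> n" for m
    using that
  proof (induction m)
    case (Suc m)
    then show ?case using of_nat_nonzero[of "Suc m"] by (simp del: of_nat_Suc mult_Suc)
  qed simp
  then show ?thesis by simp
qed

lemma minus_constant_order_ge: "x - component 0 x \<in> order_ge q"
  unfolding order_ge_def mem_Collect_eq
proof (intro allI impI)
  fix d assume "d < q"
  show "component d (x - component 0 x) = 0"
  proof (cases "d = 0")
    case True
    then show ?thesis
      using component_homogeneous[OF component_in[of 0 x]] by (simp add: component_diff)
  next
    case False
    then show ?thesis using gap[of d] \<open>d < q\<close> component_in by blast
  qed
qed

lemma homogeneous_order_ge:
  assumes "b \<in> A e" "0 < e"
  shows "b \<in> order_ge q"
  using minus_constant_order_ge[of b] component_homogeneous[OF assms(1), of 0] assms(2) by simp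

text \<open>
  Products of \<open>n + 1\<close> elements of positive degree have order at least \<open>(n + 1) q\<close>.  So the cut-off
  removes the contribution of the full set of slots in \<open>log_form_mult_slots\<close>.
\<close>

definition low_log :: "('a list \<Rightarrow>\<^sub>0 'k) \<Rightarrow> 'a"
  where "low_log f = truncation ((n + 1) * q) (log_map n f)"

lemma linear_low_log: "Vector_Spaces.linear free_smult scale low_log"
  using Vector_Spaces.linear_compose[OF linear_log_map linear_truncation]
  by (simp add: low_log_def[abs_def] o_def)

lemma linear_times: "Vector_Spaces.linear scale scale ((*) b)"
  by (simp add: Vector_Spaces.linear_iff vector_space_axioms distrib_left scale_mult_right)

lemma low_log_rels: "r \<in> rels n \<Longrightarrow> low_log r = 0"
  by (simp add: low_log_def log_map_tensor_rel truncation_order_ge order_ge_def)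

lemma low_log_permute:
  assumes p: "p permutes {..<n}" and f: "f \<in> carrier (free_algebra n)"
  shows "low_log (free_permute p f) = low_log f"
proof -
  have "(low_log \<circ> free_permute p) f = low_log f"
    by (rule linear_eq_on_carrier[OF Vector_Spaces.linear_compose[OF linear_free_permute linear_low_log]
          linear_low_log f])
      (simp add: low_log_def log_form_permute[OF p])
  then show ?thesis by simp
qed

lemma low_log_bracket_mult:
  assumes f: "f \<in> carrier (free_algebra n)" and b: "b \<in> A e" "0 < e"
  shows "low_log (free_mult (bracket_lift n b) f) = truncation ((n + 1) * q) (b * augmentation n f)"
proof -
  have "(low_log \<circ> free_mult (bracket_lift n b)) f =
      (truncation ((n + 1) * q) \<circ> ((*) b \<circ> augmentation n)) f"
  proof (rule linear_eq_on_carrier[OF _ _ f])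
    show "Vector_Spaces.linear free_smult scale (low_log \<circ> free_mult (bracket_lift n b))"
      by (rule Vector_Spaces.linear_compose[OF linear_free_mult_right linear_low_log])
    show "Vector_Spaces.linear free_smult scale (truncation ((n + 1) * q) \<circ> ((*) b \<circ> augmentation n))"
      by (intro Vector_Spaces.linear_compose[OF _ linear_truncation]
          Vector_Spaces.linear_compose[OF linear_augmentation linear_times])
    fix u :: "'a list" assume u: "length u = n"
    interpret L: Vector_Spaces.linear free_smult scale "log_map n" by (rule linear_log_map)
    interpret T: Vector_Spaces.linear scale scale "truncation m" for m
      by (rule linear_truncation)
    have "slot_product n {..<n} u \<in> order_ge (card {..<n} * q)"
      unfolding slot_product_def by (rule order_ge_prod) (auto intro: minus_constant_order_ge)
    then have "b * slot_product n {..<n} u \<in> order_ge (q + n * q)"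
      using order_ge_mult[OF homogeneous_order_ge[OF b]] by simp
    then have high: "truncation ((n + 1) * q) (b * slot_product n {..<n} u) = 0"
      by (intro truncation_order_ge) simp
    have "log_map n (free_mult (bracket_lift n b) (tuple u)) =
        b * (slot_product n {} u + scale (of_nat n * log_weight n n) (slot_product n {..<n} u))"
      using log_form_mult_slots[OF n_pos of_nat_fact_nonzero u b]
      by (simp add: bracket_lift_mult_tuple[OF u] L.sum)
    then show "(low_log \<circ> free_mult (bracket_lift n b)) (tuple u) =
        (truncation ((n + 1) * q) \<circ> ((*) b \<circ> augmentation n)) (tuple u)"
      using high by (simp add: low_log_def distrib_left scale_mult_right T.add T.scale)
  qed
  then show ?thesis by simp
qed

lemma low_log_bracket_lift:
  assumes "b \<in> A d" "0 < d" "d < (n + 1) * q"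
  shows "low_log (bracket_lift n b) = b"
proof -
  have one: "tuple (replicate n 1) \<in> carrier (free_algebra n)" by (simp add: free_algebra_simps)
  have "free_mult (bracket_lift n b) (tuple (replicate n 1)) = bracket_lift n b"
    unfolding bracket_lift_mult_tuple[OF length_replicate]
    by (simp add: bracket_lift_def)
  then show ?thesis
    using low_log_bracket_mult[OF one assms(1,2)] truncation_homogeneous[OF assms(1,3)]
    by (simp only: augmentation_one mult_1_right)
qed

text \<open>
  Induction on the number of entries of positive degree.  Let \<open>b\<close> be such an entry and replace it by
  \<open>1\<close> to obtain \<open>v\<close>.  In the vanishing sum for \<open>v\<close> and \<open>b\<close>, the slots \<open>j\<close> where \<open>v\<close> is scalar give \<open>psi u\<close>
  each, since \<open>b\<close> can be moved back by a transposition; the other slots give tuples with fewer entries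
  of positive degree.  So a multiple of \<open>psi u\<close> by a number between \<open>1\<close> and \<open>n\<close> vanishes.
\<close>

lemma symmetric_form_vanishes:
  fixes psi :: "'a list \<Rightarrow> 'a"
  assumes scaling: "\<And>u i c x. length u = n \<Longrightarrow> i < n \<Longrightarrow> psi (u[i := scale c x]) = scale c (psi (u[i := x]))"
    and sym: "\<And>u p. length u = n \<Longrightarrow> p permutes {..<n} \<Longrightarrow> psi (permute_list p u) = psi u"
    and bracket: "\<And>u b e. length u = n \<Longrightarrow> b \<in> A e \<Longrightarrow> 0 < e \<Longrightarrow> (\<Sum>j<n. psi (u[j := b * u ! j])) = 0"
    and u: "length u = n" "length ds = n" "\<And>i. i < n \<Longrightarrow> u ! i \<in> A (ds ! i)" "0 < sum_list ds"
  shows "psi u = 0"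
  using u
proof (induction "card {i. i < n \<and> 0 < ds ! i}" arbitrary: u ds rule: less_induct)
  case less
  obtain i where i: "i < n" "0 < ds ! i"
    using less.prems(2,4) by (metis gr0I in_set_conv_nth sum_list_eq_0_iff less_irrefl)
  define b where "b = u ! i"
  define v where "v = u[i := 1]"
  define Z where "Z = {j. j < n \<and> ds[i := 0] ! j = 0}"
  have b: "b \<in> A (ds ! i)" using less.prems i by (simp add: b_def)
  have v: "length v = n" using less.prems by (simp add: v_def)
  have same: "psi (v[j := b * v ! j]) = psi u" if j: "j \<in> Z" for j
  proof (cases "j = i")
    case True
    then show ?thesis using less.prems i by (simp add: v_def b_def)
  next
    case False
    with j have "j < n" "ds ! j = 0" by (auto simp: Z_def)
    then obtain c where c: "u ! j = scale c 1" using less.prems(3)[of j] in_A0D by auto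
    have swap: "Transposition.transpose i j permutes {..<n}"
      using i \<open>j < n\<close> by (intro permutes_swap_id) auto
    have "permute_list (Transposition.transpose i j) (u[j := 1]) = v[j := b]"
      using less.prems i \<open>j < n\<close> False
      by (intro nth_equalityI)
        (auto simp: permute_list_nth[of _ "u[j := 1]"] swap v_def b_def nth_list_update Transposition.transpose_def)
    then have "psi (v[j := b]) = psi (u[j := 1])"
      using sym[OF _ swap, of "u[j := 1]"] less.prems by simp
    moreover have "psi (v[j := b * v ! j]) = scale c (psi (v[j := b]))"
      using scaling[OF v \<open>j < n\<close>, of c b] c False by (simp add: v_def scale_mult_right)
    moreover have "psi u = scale c (psi (u[j := 1]))"
      using scaling[OF less.prems(1) \<open>j < n\<close>, of c 1] c by (metis list_update_id)
    ultimately show ?thesis by simp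
  qed
  have fewer: "psi (v[j := b * v ! j]) = 0" if "j < n" "j \<notin> Z" for j
  proof -
    from that have j: "j < n" "j \<noteq> i" "0 < ds ! j"
      using i less.prems by (auto simp: Z_def nth_list_update split: if_splits)
    define es where "es = ds[i := 0, j := ds ! i + ds ! j]"
    have es: "length es = n" "es ! j = ds ! i + ds ! j" using less.prems j by (simp_all add: es_def)
    have "{k. k < n \<and> 0 < es ! k} \<subset> {k. k < n \<and> 0 < ds ! k}"
      using i j less.prems by (auto simp: es_def nth_list_update split: if_splits)
    then have "card {k. k < n \<and> 0 < es ! k} < card {k. k < n \<and> 0 < ds ! k}"
      by (intro psubset_card_mono) auto
    then show ?thesis
    proof (rule less.hyps)
      show "0 < sum_list es"
        using es i j by (metis add_gr_0 gr0I nth_mem sum_list_eq_0_iff less_irrefl)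
      show "v[j := b * v ! j] ! k \<in> A (es ! k)" if "k < n" for k
        using that less.prems i j comp_mult[OF b] one_in_A0
        by (auto simp: v_def es_def nth_list_update)
    qed (use v es in auto)
  qed
  have Z: "finite Z" "i \<in> Z" "Z \<subseteq> {..<n}" using i less.prems by (auto simp: Z_def)
  then have "card Z \<le> n" using card_mono[of "{..<n}" Z] by simp
  moreover have "0 < card Z" using Z by (auto simp: card_gt_0_iff)
  ultimately have nonzero: "of_nat (card Z) \<noteq> (0::'k)" by (intro of_nat_nonzero)
  have "0 = (\<Sum>j<n. psi (v[j := b * v ! j]))"
    using bracket[OF v b i(2)] by simp
  also have "\<dots> = (\<Sum>j\<in>Z. psi u)"
    using Z by (intro sum.mono_neutral_cong_right) (auto simp: same fewer)
  also have "\<dots> = scale (of_nat (card Z)) (psi u)" by (simp add: of_nat_mult_eq_scale)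
  finally show ?case using nonzero by (metis scale_eq_0_iff)
qed

text \<open>
  The form \<open>u \<mapsto> low_log (u g)\<close> is symmetric because \<open>g\<close> is invariant, and it satisfies the bracket
  condition because \<open>u g\<close> has augmentation zero.
\<close>

lemma low_log_mult:
  assumes f: "f \<in> tensor_lift n d" and g: "g \<in> sym_lift n e" and d: "0 < d" and e: "0 < e"
  shows "low_log (free_mult f g) = 0"
proof -
  interpret L: Vector_Spaces.linear free_smult scale low_log by (rule linear_low_log)
  have gc: "g \<in> carrier (free_algebra n)" and gt: "g \<in> tensor_lift n e"
    using g by (auto simp: sym_lift_closed, simp add: sym_lift_def)
  have carr: "tuple u \<in> carrier (free_algebra n)" if "length u = n" for u :: "'a list"
    using that by (simp add: free_algebra_simps)
  have tuples: "low_log (free_mult (tuple u) g) = 0" if u: "u \<in> homogeneous_tuples n d" for u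
  proof -
    obtain ds where ds: "length u = n" "length ds = n" "sum_list ds = d" "\<And>i. i < n \<Longrightarrow> u ! i \<in> A (ds ! i)"
      using u unfolding homogeneous_tuples_def by blast
    show ?thesis
    proof (rule symmetric_form_vanishes[of "\<lambda>u. low_log (free_mult (tuple u) g)", OF _ _ _ ds(1,2,4)])
      show "0 < sum_list ds" using ds d by simp
    next
      fix u :: "'a list" and i c x assume u: "length u = n" "i < n"
      have "tuple (u[i := scale c x]) - Poly_Mapping.single (u[i := x]) c \<in> rels n"
        unfolding tensor_rel_def by (intro free_space.span_base multilinear_rels.scale u)
      from low_log_rels[OF rels_mult_left[OF gc this]]
      show "low_log (free_mult (tuple (u[i := scale c x])) g) = scale c (low_log (free_mult (tuple (u[i := x])) g))"
        using free_mult_diff_right[of g "tuple (u[i := scale c x])" "Poly_Mapping.single (u[i := x]) c"]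
          free_mult_smult_right[of g c "tuple (u[i := x])"]
        by (simp add: free_mult_commute[of _ g] L.diff L.scale)
    next
      fix u :: "'a list" and p assume u: "length u = n" and p: "p permutes {..<n}"
      let ?v = "tuple (permute_list p u) :: 'a list \<Rightarrow>\<^sub>0 'k"
      have v: "?v \<in> carrier (free_algebra n)" using u by (intro carr) simp
      have "free_permute p g - g \<in> rels n"
        using g p by (simp add: sym_lift_def invariant_lift_def)
      then have "low_log (free_mult ?v (free_permute p g - g)) = 0"
        by (intro low_log_rels rels_mult_right v)
      then have "low_log (free_mult ?v g) = low_log (free_mult ?v (free_permute p g))"
        by (simp add: free_mult_diff_right L.diff)
      also have "free_mult ?v (free_permute p g) = free_permute p (free_mult (tuple u) g)"
        by (simp add: free_permute_mult[OF p carr[OF u] gc])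
      also have "low_log \<dots> = low_log (free_mult (tuple u) g)"
        by (intro low_log_permute p free_mult_closed carr u gc)
      finally show "low_log (free_mult ?v g) = low_log (free_mult (tuple u) g)" .
    next
      fix u :: "'a list" and b e' assume u: "length u = n" and b: "b \<in> A e'" "0 < e'"
      have "(\<Sum>j<n. low_log (free_mult (tuple (u[j := b * u ! j])) g)) =
          low_log (free_mult (bracket_lift n b) (free_mult (tuple u) g))"
        by (simp add: bracket_lift_mult_tuple[OF u] free_mult_sum_left L.sum flip: free_mult_assoc)
      also have "\<dots> = 0"
        using low_log_bracket_mult[OF free_mult_closed[OF carr[OF u] gc] b]
          augmentation_mult_positive[OF carr[OF u] gt e]
        by (simp add: truncation_def)
      finally show "(\<Sum>j<n. low_log (free_mult (tuple (u[j := b * u ! j])) g)) = 0" .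
    qed
  qed
  obtain h where h: "h \<in> homogeneous_space n d" "f - h \<in> rels n"
    using f by (auto simp: tensor_lift_def)
  have "(low_log \<circ> (\<lambda>f. free_mult f g)) h \<in> {0}"
    by (rule linear_into_subspace[OF Vector_Spaces.linear_compose[OF linear_free_mult_left linear_low_log]
        subspace_single_0]) (use h(1) tuples in \<open>auto simp: homogeneous_space_def\<close>)
  moreover have "low_log (free_mult (f - h) g) = 0"
    by (intro low_log_rels rels_mult_left gc h)
  moreover have "free_mult f g = free_mult h g + free_mult (f - h) g"
    by (simp flip: free_mult_add_left)
  ultimately show ?thesis by (simp add: L.add)
qed

end

section \<open>Preimages of the augmentation ideal and its square\<close>

lemma independent_Un_kernel:
  assumes lin: "Vector_Spaces.linear s1 s2 f"
    and C: "\<not> module.dependent s1 C" "\<And>x. x \<in> C \<Longrightarrow> f x = 0"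
    and B: "inj_on f B" "\<not> module.dependent s2 (f ` B)"
  shows "\<not> module.dependent s1 (B \<union> C)"
proof -
  interpret f: Vector_Spaces.linear s1 s2 f by fact
  show ?thesis
    unfolding f.vs1.independent_explicit_module
  proof (intro allI impI)
    fix t u v
    assume t: "finite t" "t \<subseteq> B \<union> C" "(\<Sum>v\<in>t. s1 (u v) v) = 0" "v \<in> t"
    have "0 = f (\<Sum>v\<in>t. s1 (u v) v)" using t by (simp add: f.zero)
    also have "\<dots> = (\<Sum>v\<in>t. s2 (u v) (f v))" by (simp add: f.sum f.scale)
    also have "\<dots> = (\<Sum>v\<in>t - C. s2 (u v) (f v))"
      using t C(2) by (intro sum.mono_neutral_right) auto
    also have "\<dots> = (\<Sum>w\<in>f ` (t - C). s2 (u (the_inv_into B f w)) w)"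
    proof -
      have sub: "t - C \<subseteq> B" using t by auto
      then have "inj_on f (t - C)" using B(1) inj_on_subset by blast
      then show ?thesis
        using sub by (simp add: sum.reindex the_inv_into_f_f[OF B(1)] subset_iff)
    qed
    finally have "(\<Sum>w\<in>f ` (t - C). s2 (u (the_inv_into B f w)) w) = 0" ..
    moreover have "f ` (t - C) \<subseteq> f ` B" using t by auto
    ultimately have zero: "u w = 0" if "w \<in> t - C" for w
      using f.vs2.independentD[OF B(2), of "f ` (t - C)" "\<lambda>w. u (the_inv_into B f w)" "f w"] t that
        the_inv_into_f_f[OF B(1), of w] by auto
    show "u v = 0"
    proof (cases "v \<in> C")
      case True
      have "(\<Sum>v\<in>t \<inter> C. s1 (u v) v) = (\<Sum>v\<in>t. s1 (u v) v)"
        using t zero by (intro sum.mono_neutral_left) auto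
      then show ?thesis
        using f.vs1.independentD[OF C(1), of "t \<inter> C" u v] t True by simp
    qed (use t zero in auto)
  qed
qed

context connected_graded_algebra
begin

context
  fixes n :: nat
begin

lemma sym_invariants_ops:
  assumes "f \<in> carrier (free_algebra n)" "g \<in> carrier (free_algebra n)"
  shows "tensor_class scale n f \<oplus>\<^bsub>sym_invariants scale n\<^esub> tensor_class scale n g = tensor_class scale n (f + g)"
    and "tensor_class scale n f \<otimes>\<^bsub>sym_invariants scale n\<^esub> tensor_class scale n g =
      tensor_class scale n (free_mult f g)"
  using ring_hom_add[OF tensor_class_hom assms] ring_hom_mult[OF tensor_class_hom assms]
  by (simp_all add: sym_invariants_def free_algebra_simps)

lemma sym_invariants_one:
  "\<one>\<^bsub>sym_invariants scale n\<^esub> = tensor_class scale n (tuple (replicate n 1))"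
  using ring_hom_one[OF tensor_class_hom] by (simp add: sym_invariants_def free_algebra_simps)

lemma sym_invariants_zero: "\<zero>\<^bsub>sym_invariants scale n\<^esub> = tensor_class scale n 0"
  by (simp add: sym_invariants_def tensor_power_def FactRing_def tensor_class_eq)

lemma invariant_lift_closed: "f \<in> invariant_lift n \<Longrightarrow> f \<in> carrier (free_algebra n)"
  by (simp add: invariant_lift_def)

lemma sym_invariants_neg:
  assumes "f \<in> invariant_lift n"
  shows "\<ominus>\<^bsub>sym_invariants scale n\<^esub> tensor_class scale n f = tensor_class scale n (- f)"
proof -
  interpret R: cring "sym_invariants scale n" by (rule cring_sym_invariants)
  have "- f \<in> invariant_lift n"
    using free_space.subspace_neg[OF subspace_invariant_lift assms] .
  with assms show ?thesis
    by (intro R.minus_equality)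
      (auto simp: carrier_sym_invariants_eq sym_invariants_ops sym_invariants_zero invariant_lift_closed)
qed

definition positive_lift :: "('a list \<Rightarrow>\<^sub>0 'k) set"
  where "positive_lift = free_space.span (\<Union>d\<in>{0<..}. sym_lift n d)"

definition decomposable_lift :: "('a list \<Rightarrow>\<^sub>0 'k) set"
  where "decomposable_lift =
    free_space.span ({free_mult f g | f g d e. f \<in> sym_lift n d \<and> g \<in> sym_lift n e \<and> 0 < d \<and> 0 < e} \<union> rels n)"

lemma positive_lift_invariant: "positive_lift \<subseteq> invariant_lift n"
  unfolding positive_lift_def
  by (intro free_space.span_minimal subspace_invariant_lift) (auto dest: sym_lift_invariant)

lemma rels_subset_decomposable: "rels n \<subseteq> decomposable_lift"
  by (auto simp: decomposable_lift_def intro: free_space.span_base)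

lemma decomposable_subset_positive: "decomposable_lift \<subseteq> positive_lift"
proof -
  have "rels n \<subseteq> sym_lift n 1" by (rule rels_subset_sym_lift)
  then have "{free_mult f g | f g d e. f \<in> sym_lift n d \<and> g \<in> sym_lift n e \<and> 0 < d \<and> 0 < e} \<union> rels n
      \<subseteq> (\<Union>d\<in>{0<..}. sym_lift n d)"
    using sym_lift_mult by fastforce
  then show ?thesis unfolding positive_lift_def decomposable_lift_def by (rule free_space.span_mono)
qed

lemma positive_lift_mult:
  assumes "f \<in> positive_lift" "g \<in> positive_lift"
  shows "free_mult f g \<in> decomposable_lift"
  using assms(1) unfolding positive_lift_def
proof (induction rule: free_space.span_induct_alt)
  case base
  then show ?case by (simp add: decomposable_lift_def free_space.span_zero)
next
  case (step c f f')
  have "free_mult f g \<in> decomposable_lift"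
    using assms(2) unfolding positive_lift_def
  proof (induction rule: free_space.span_induct_alt)
    case base
    then show ?case by (simp add: decomposable_lift_def free_space.span_zero)
  next
    case (step d g g')
    then have "free_mult f g \<in> decomposable_lift"
      using \<open>f \<in> (\<Union>d\<in>{0<..}. sym_lift n d)\<close> unfolding decomposable_lift_def
      by (intro free_space.span_base) fastforce
    with step(2) show ?case
      unfolding decomposable_lift_def
      by (simp add: free_mult_add_right free_mult_smult_right free_space.span_add free_space.span_scale)
  qed
  with step(2) show ?case
    unfolding decomposable_lift_def
    by (simp add: free_mult_add_left free_mult_commute[of "free_smult c f"] free_mult_commute[of f]
        free_mult_smult_right free_space.span_add free_space.span_scale)
qed

lemma positive_part_sym_subset:
  "positive_part (sym_invariants scale n) (sym_comp scale A n) \<subseteq> tensor_class scale n ` positive_lift"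
proof
  interpret R: cring "sym_invariants scale n" by (rule cring_sym_invariants)
  fix X assume "X \<in> positive_part (sym_invariants scale n) (sym_comp scale A n)"
  then obtain x D where X: "X = finsum (sym_invariants scale n) x D" and D: "finite D" "0 \<notin> D"
    "\<forall>d\<in>D. x d \<in> sym_comp scale A n d"
    by (auto simp: positive_part_def)
  have "finsum (sym_invariants scale n) x D \<in> tensor_class scale n ` positive_lift"
    using D
  proof (induction D rule: finite_induct)
    case empty
    then show ?case
      by (auto simp: sym_invariants_zero positive_lift_def free_space.span_zero)
  next
    case (insert d D)
    then obtain g where g: "g \<in> positive_lift" "finsum (sym_invariants scale n) x D = tensor_class scale n g"
      by auto
    obtain f where f: "f \<in> sym_lift n d" "x d = tensor_class scale n f"
      using insert.prems by (auto simp: sym_comp_eq)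
    have fp: "f \<in> positive_lift"
      using f(1) insert.prems unfolding positive_lift_def by (intro free_space.span_base) auto
    have "x \<in> D \<rightarrow> carrier (sym_invariants scale n)" "x d \<in> carrier (sym_invariants scale n)"
      using insert.prems by (auto simp: sym_comp_def)
    then have "finsum (sym_invariants scale n) x (insert d D) =
        x d \<oplus>\<^bsub>sym_invariants scale n\<^esub> finsum (sym_invariants scale n) x D"
      using insert.hyps by (intro R.finsum_insert)
    also have "\<dots> = tensor_class scale n (f + g)"
      using f g fp positive_lift_invariant
      by (simp add: sym_invariants_ops invariant_lift_closed subset_iff)
    also have "\<dots> \<in> tensor_class scale n ` positive_lift"
      using fp g(1) by (auto simp: positive_lift_def intro: free_space.span_add)
    finally show ?case .
  qed
  then show "X \<in> tensor_class scale n ` positive_lift" using X by simp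
qed

lemma square_positive_part_subset:
  "positive_part (sym_invariants scale n) (sym_comp scale A n) \<cdot>\<^bsub>sym_invariants scale n\<^esub>
    positive_part (sym_invariants scale n) (sym_comp scale A n) \<subseteq> tensor_class scale n ` decomposable_lift"
proof
  fix X assume "X \<in> positive_part (sym_invariants scale n) (sym_comp scale A n) \<cdot>\<^bsub>sym_invariants scale n\<^esub>
    positive_part (sym_invariants scale n) (sym_comp scale A n)"
  then show "X \<in> tensor_class scale n ` decomposable_lift"
  proof (induction rule: ideal_prod.induct)
    case (prod X Y)
    then obtain f g where "f \<in> positive_lift" "X = tensor_class scale n f"
      "g \<in> positive_lift" "Y = tensor_class scale n g"
      using positive_part_sym_subset by blast
    then show ?case
      using positive_lift_invariant positive_lift_mult
      by (auto simp: sym_invariants_ops invariant_lift_closed subset_iff)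
  next
    case (sum X Y)
    then obtain f g where fg: "f \<in> decomposable_lift" "X = tensor_class scale n f"
      "g \<in> decomposable_lift" "Y = tensor_class scale n g"
      by blast
    then have "f + g \<in> decomposable_lift"
      by (simp add: decomposable_lift_def free_space.span_add)
    with fg show ?case
      using positive_lift_invariant decomposable_subset_positive
      by (auto simp: sym_invariants_ops invariant_lift_closed subset_iff)
  qed
qed

lemma bracket_eq_lift: "bracket scale n b = tensor_class scale n (bracket_lift n b)"
  by (simp add: bracket_eq bracket_lift_def)

section \<open>Generating systems of the invariants\<close>

text \<open>
  All entries are scalars, which can be pulled out of the slots one by one.
\<close>

lemma homogeneous_tuple_degree_0:
  assumes "u \<in> homogeneous_tuples n 0"
  shows "\<exists>c. tuple u - Poly_Mapping.single (replicate n 1) c \<in> rels n"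
proof -
  have u: "length u = n" "\<And>i. i < n \<Longrightarrow> u ! i \<in> A 0"
    using assms by (auto simp: homogeneous_tuples_def sum_list_eq_0_iff) (metis nth_mem)
  have "\<exists>c. tuple u - Poly_Mapping.single (replicate k 1 @ drop k u) c \<in> rels n" if "k \<le> n" for k
    using that
  proof (induction k)
    case 0
    then show ?case using rels_zero by (auto intro!: exI[of _ 1])
  next
    case (Suc k)
    then obtain c where c: "tuple u - Poly_Mapping.single (replicate k 1 @ drop k u) c \<in> rels n" by auto
    obtain a where a: "u ! k = scale a 1" using in_A0D[OF u(2), of k] Suc.prems by auto
    let ?v = "replicate k 1 @ drop k u"
    have v: "length ?v = n" "?v ! k = scale a 1" "?v[k := 1] = replicate (Suc k) 1 @ drop (Suc k) u"
      using Suc.prems u(1) a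
      by (auto simp: nth_append list_update_append Cons_nth_drop_Suc[symmetric] replicate_append_same[symmetric]
          simp del: replicate_append_same)
    have "tuple (?v[k := scale a 1]) - Poly_Mapping.single (?v[k := 1]) a \<in> rels n"
      unfolding tensor_rel_def using Suc.prems v by (intro free_space.span_base multilinear_rels.scale) auto
    then have "free_smult c (tuple ?v - Poly_Mapping.single (?v[k := 1]) a) \<in> rels n"
      using v(2) by (intro rels_scale) (metis list_update_id)
    from rels_add[OF c this] show ?case
      using v(3) by (auto simp: free_space.scale_right_diff_distrib)
  qed
  from this[of n] u show ?thesis by simp
qed

lemma tensor_lift_degree_0:
  assumes "f \<in> tensor_lift n 0"
  shows "\<exists>c. f - Poly_Mapping.single (replicate n 1) c \<in> rels n"
proof -
  let ?W = "{f. \<exists>c. f - Poly_Mapping.single (replicate n 1) c \<in> rels n}"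
  have W: "free_space.subspace ?W"
  proof (rule free_space.subspaceI)
    show "0 \<in> ?W" using rels_zero by (auto intro!: exI[of _ 0])
  next
    fix f g assume "f \<in> ?W" "g \<in> ?W"
    then obtain c d where "f - Poly_Mapping.single (replicate n 1) c \<in> rels n"
      "g - Poly_Mapping.single (replicate n 1) d \<in> rels n" by auto
    from rels_add[OF this] show "f + g \<in> ?W"
      by (auto simp: single_add algebra_simps intro!: exI[of _ "c + d"])
  next
    fix a f assume "f \<in> ?W"
    then obtain c where "f - Poly_Mapping.single (replicate n 1) c \<in> rels n" by auto
    from rels_scale[OF this, of a] show "free_smult a f \<in> ?W"
      by (auto simp: free_space.scale_right_diff_distrib)
  qed
  obtain h where h: "h \<in> homogeneous_space n 0" "f - h \<in> rels n"
    using assms by (auto simp: tensor_lift_def)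
  have "id h \<in> ?W"
    by (rule linear_into_subspace[OF free_space.linear_id W])
      (use h(1) homogeneous_tuple_degree_0 in \<open>auto simp: homogeneous_space_def\<close>)
  moreover have "f - h \<in> ?W" using h(2) by (auto intro!: exI[of _ 0])
  ultimately have "id h + (f - h) \<in> ?W" by (rule free_space.subspace_add[OF W])
  then show ?thesis by simp
qed

lemma scalar_invariant: "Poly_Mapping.single (replicate n 1) c \<in> invariant_lift n"
  using rels_zero by (auto simp: invariant_lift_def free_algebra_simps permute_replicate)

lemma scalar_mult:
  "f \<in> carrier (free_algebra n) \<Longrightarrow> free_mult (Poly_Mapping.single (replicate n 1) c) f = free_smult c f"
  using free_mult_smult_right[of f c "tuple (replicate n 1)"] free_mult_one[of f n]
  by (simp add: free_mult_commute)

text \<open>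
  By induction on \<open>d\<close>, the generated subalgebra \<open>S\<close> contains all invariants of degree \<open>d\<close>.  Write such an
  invariant as a combination of elements of \<open>G\<close> and of products of homogeneous invariants of positive
  degree, and project to degree \<open>d\<close>: what survives is in \<open>G\<close> or is a product of invariants of degree
  less than \<open>d\<close>.
\<close>

lemma generating_if_spanning:
  assumes G: "G \<subseteq> (\<Union>d\<in>{0<..}. sym_lift n d)" and C: "C \<subseteq> decomposable_lift"
    and span: "(\<Union>d\<in>{0<..}. sym_lift n d) \<subseteq> free_space.span (G \<union> C)"
  shows "generating_system (sym_invariants scale n) (tensor_scalars scale n) (tensor_class scale n ` G)"
proof -
  let ?R = "sym_invariants scale n"
  interpret R: cring ?R by (rule cring_sym_invariants)
  define T where "T = generate_ring ?R (tensor_scalars scale n \<union> tensor_class scale n ` G)"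
  define S where "S = {f \<in> invariant_lift n. tensor_class scale n f \<in> T}"
  have carr: "f \<in> carrier (free_algebra n)" if "f \<in> S" for f
    using that by (simp add: S_def invariant_lift_closed)
  have S_scalar: "Poly_Mapping.single (replicate n 1) c \<in> S" for c
    by (auto simp: S_def T_def scalar_invariant tensor_scalars_def intro: generate_ring.incl)
  have S_mult: "free_mult f g \<in> S" if "f \<in> S" "g \<in> S" for f g
    using that carr[OF that(1)] carr[OF that(2)]
    by (auto simp: S_def T_def invariant_lift_mult simp flip: sym_invariants_ops intro: generate_ring.eng_mult)
  have S_add: "f + g \<in> S" if "f \<in> S" "g \<in> S" for f g
    using that carr[OF that(1)] carr[OF that(2)]
    by (auto simp: S_def T_def free_space.subspace_add[OF subspace_invariant_lift] simp flip: sym_invariants_ops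
        intro: generate_ring.eng_add)
  have S: "free_space.subspace S"
  proof (rule free_space.subspaceI)
    show "0 \<in> S" using S_scalar[of 0] by simp
    show "free_smult c f \<in> S" if "f \<in> S" for c f
      using S_mult[OF S_scalar that] scalar_mult[OF carr[OF that]] by simp
  qed (rule S_add)
  have S_cong: "g \<in> S" if "f \<in> S" "g - f \<in> rels n" for f g
    using that invariant_lift_cong[of f n g] by (auto simp: S_def tensor_class_eq_iff[symmetric])
  have S_rels: "rels n \<subseteq> S" using S_cong[OF free_space.subspace_0[OF S]] by auto
  have degree: "sym_lift n d \<subseteq> S" for d
  proof (induction d rule: less_induct)
    case (less d)
    show ?case
    proof (cases "d = 0")
      case True
      then show ?thesis
        using tensor_lift_degree_0 S_cong[OF S_scalar] by (fastforce simp: sym_lift_def)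
    next
      case False
      interpret L: Vector_Spaces.linear free_smult free_smult "degree_part n d"
        by (rule linear_degree_part)
      have part: "degree_part n d f \<in> S" if "f \<in> sym_lift n e" "e = d \<Longrightarrow> f \<in> S" for f e
        using degree_part_of_homogeneous[of f n e d] that S_rels S_cong[of f "degree_part n d f"]
        by (auto simp: sym_lift_def split: if_splits)
      have products: "degree_part n d (free_mult f g) \<in> S"
        if "f \<in> sym_lift n a" "g \<in> sym_lift n b" "0 < a" "0 < b" for f g a b
        using that less.IH[of a] less.IH[of b]
        by (intro part[OF sym_lift_mult[OF that(1,2)]] S_mult) auto
      have preimage: "free_space.subspace (degree_part n d -` S)"
        using S by (simp add: free_space.subspace_def L.zero L.add L.scale)
      have rels: "rels n \<subseteq> degree_part n d -` S"
        using degree_part_rels[of _ n d] S_rels by blast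
      have "decomposable_lift \<subseteq> degree_part n d -` S"
        unfolding decomposable_lift_def
        by (rule free_space.span_minimal[OF _ preimage]) (use products rels in auto)
      moreover have "G \<subseteq> degree_part n d -` S"
      proof
        fix g assume "g \<in> G"
        moreover from this have "g \<in> S"
          using G by (auto simp: S_def T_def sym_lift_invariant intro: generate_ring.incl)
        ultimately show "g \<in> degree_part n d -` S" using G part by auto
      qed
      ultimately have "free_space.span (G \<union> C) \<subseteq> degree_part n d -` S"
        using C by (intro free_space.span_minimal preimage) auto
      show ?thesis
      proof
        fix f assume f: "f \<in> sym_lift n d"
        with False span \<open>free_space.span (G \<union> C) \<subseteq> degree_part n d -` S\<close>
        have "degree_part n d f \<in> S" by auto
        moreover have "f - degree_part n d f \<in> rels n"
          using f degree_part_of_homogeneous[of f n d d] free_space.subspace_neg[OF subspace_rels]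
          by (metis IntD1 minus_diff_eq sym_lift_def)
        ultimately show "f \<in> S" by (rule S_cong)
      qed
    qed
  qed
  have "invariant_lift n \<subseteq> S"
  proof
    fix f assume f: "f \<in> invariant_lift n"
    obtain D where "f - (\<Sum>d<D. degree_part n d f) \<in> rels n"
      using sum_degree_parts[OF invariant_lift_closed[OF f]] by auto
    moreover have "(\<Sum>d<D. degree_part n d f) \<in> S"
      using degree degree_part_invariant[OF f] by (intro free_space.subspace_sum[OF S]) auto
    ultimately show "f \<in> S" by (rule S_cong[rotated])
  qed
  then have "carrier ?R \<subseteq> T" by (auto simp: carrier_sym_invariants_eq S_def)
  moreover have "T \<subseteq> carrier ?R"
    unfolding T_def
    using G by (intro R.generate_ring_incl)
      (auto simp: tensor_scalars_def carrier_sym_invariants_eq scalar_invariant dest: sym_lift_invariant)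
  ultimately show ?thesis by (simp add: generating_system_def T_def)
qed

lemma augmentation_positive:
  assumes "f \<in> positive_lift"
  shows "augmentation n f = 0"
proof -
  interpret L: Vector_Spaces.linear free_smult scale "augmentation n" by (rule linear_augmentation)
  have one: "tuple (replicate n 1) \<in> carrier (free_algebra n)" by (simp add: free_algebra_simps)
  show ?thesis
    using assms unfolding positive_lift_def
  proof (induction rule: free_space.span_induct_alt)
    case (step c f g)
    then obtain d where d: "0 < d" "f \<in> tensor_lift n d" by (auto simp: sym_lift_def)
    then have "augmentation n f = 0"
      using augmentation_mult_positive[OF one d(2,1)] free_mult_one[OF tensor_lift_closed[OF d(2)]]
      by simp
    with step(2) show ?case by (simp add: L.add L.scale)
  qed (simp add: L.zero)
qed

text \<open>
  Let \<open>H'\<close> be the part of \<open>G\<close> that lies over \<open>H\<close>.  Since products of two elements of positive degree are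
  decomposable, the sum of the scalars, the span of \<open>H'\<close> and the decomposable elements is already a
  subalgebra.  If it contains an element of \<open>G\<close>, then the augmentation shows that no scalar is involved,
  and independence puts the element into \<open>H'\<close>.
\<close>

lemma minimal_if_independent:
  assumes G: "G \<subseteq> (\<Union>d\<in>{0<..}. sym_lift n d)" and C: "free_space.span C = decomposable_lift"
    and disjoint: "G \<inter> C = {}" and indep: "\<not> free_space.dependent (G \<union> C)"
    and H: "H \<subset> tensor_class scale n ` G"
  shows "\<not> generating_system (sym_invariants scale n) (tensor_scalars scale n) H"
proof
  let ?R = "sym_invariants scale n"
  assume gen: "generating_system ?R (tensor_scalars scale n) H"
  obtain g where g: "g \<in> G" "tensor_class scale n g \<notin> H" using H by auto
  define H' where "H' = {h \<in> G. tensor_class scale n h \<in> H}"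
  define L where "L = free_space.span (H' \<union> C)"
  let ?one = "Poly_Mapping.single (replicate n 1) :: 'k \<Rightarrow> _"
  have C_L: "decomposable_lift \<subseteq> L"
    unfolding L_def C[symmetric] by (intro free_space.span_mono) auto
  have H_P: "H' \<subseteq> positive_lift"
    using G unfolding positive_lift_def H'_def by (auto intro: free_space.span_base)
  have L_P: "L \<subseteq> positive_lift"
    unfolding L_def
  proof (rule free_space.span_minimal)
    show "H' \<union> C \<subseteq> positive_lift"
      using H_P decomposable_subset_positive free_space.span_superset[of C] C by auto
  qed (simp add: positive_lift_def)
  have L_closed: "l \<in> invariant_lift n" if "l \<in> L" for l
    using that L_P positive_lift_invariant by auto
  have L_sub: "free_space.subspace L" by (simp add: L_def)
  have "\<exists>c. \<exists>l\<in>L. X = tensor_class scale n (?one c + l)"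
    if "X \<in> generate_ring ?R (tensor_scalars scale n \<union> H)" for X
    using that
  proof (induction rule: generate_ring.induct)
    case one
    then show ?case
      using free_space.subspace_0[OF L_sub] by (auto simp: sym_invariants_one intro!: exI[of _ 1] bexI[of _ 0])
  next
    case (incl X)
    then show ?case
    proof
      assume "X \<in> tensor_scalars scale n"
      then show ?thesis
        using free_space.subspace_0[OF L_sub] by (auto simp: tensor_scalars_def intro!: bexI[of _ 0])
    next
      assume "X \<in> H"
      then obtain h where "h \<in> H'" "X = tensor_class scale n h" using H by (auto simp: H'_def)
      then show ?thesis
        by (auto simp: L_def intro!: exI[of _ 0] bexI[of _ h] intro: free_space.span_base)
    qed
  next
    case (a_inv X)
    then obtain c l where l: "l \<in> L" "X = tensor_class scale n (?one c + l)" by auto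
    then have "?one c + l \<in> invariant_lift n"
      by (intro free_space.subspace_add[OF subspace_invariant_lift] scalar_invariant L_closed)
    then have "\<ominus>\<^bsub>?R\<^esub> X = tensor_class scale n (?one (- c) + (- l))"
      using l by (simp add: sym_invariants_neg single_uminus)
    then show ?case using free_space.subspace_neg[OF L_sub l(1)] by blast
  next
    case (eng_add X Y)
    then obtain c l c' l' where l: "l \<in> L" "X = tensor_class scale n (?one c + l)"
      "l' \<in> L" "Y = tensor_class scale n (?one c' + l')" by auto
    then have "?one c + l \<in> carrier (free_algebra n)" "?one c' + l' \<in> carrier (free_algebra n)"
      by (simp_all add: carrier_add invariant_lift_closed scalar_invariant L_closed)
    then have "X \<oplus>\<^bsub>?R\<^esub> Y = tensor_class scale n (?one (c + c') + (l + l'))"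
      using l by (simp add: sym_invariants_ops single_add algebra_simps)
    then show ?case using free_space.subspace_add[OF L_sub l(1,3)] by blast
  next
    case (eng_mult X Y)
    then obtain c l c' l' where l: "l \<in> L" "X = tensor_class scale n (?one c + l)"
      "l' \<in> L" "Y = tensor_class scale n (?one c' + l')" by auto
    have lc: "l \<in> carrier (free_algebra n)" "l' \<in> carrier (free_algebra n)"
      using l by (auto intro!: invariant_lift_closed L_closed)
    then have "?one c + l \<in> carrier (free_algebra n)" "?one c' + l' \<in> carrier (free_algebra n)"
      by (auto intro!: carrier_add invariant_lift_closed[OF scalar_invariant])
    then have "X \<otimes>\<^bsub>?R\<^esub> Y = tensor_class scale n (free_mult (?one c + l) (?one c' + l'))"
      using l by (simp add: sym_invariants_ops)
    also have "free_mult (?one c + l) (?one c' + l') =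
        ?one (c * c') + (free_smult c l' + free_smult c' l + free_mult l l')"
      using scalar_mult[OF lc(2), of c] scalar_mult[OF lc(1), of c']
        scalar_mult[OF invariant_lift_closed[OF scalar_invariant[of c']], of c]
      by (simp only: free_mult_add_left free_mult_add_right free_mult_commute[of l "?one c'"]
          free_smult_single add.assoc add.commute add.left_commute)
    finally have "X \<otimes>\<^bsub>?R\<^esub> Y =
      tensor_class scale n (?one (c * c') + (free_smult c l' + free_smult c' l + free_mult l l'))" .
    moreover have "free_mult l l' \<in> L"
      using positive_lift_mult L_P C_L l by blast
    then have "free_smult c l' + free_smult c' l + free_mult l l' \<in> L"
      using l by (intro free_space.subspace_add[OF L_sub] free_space.subspace_scale[OF L_sub])
    ultimately show ?case by blast
  qed
  moreover have "tensor_class scale n g \<in> generate_ring ?R (tensor_scalars scale n \<union> H)"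
    using gen g(1) G sym_lift_invariant[of g n]
    by (auto simp: generating_system_def carrier_sym_invariants_eq intro!: imageI)
  ultimately obtain c l where l: "l \<in> L" "g - (?one c + l) \<in> rels n"
    by (metis tensor_class_eq_iff)
  interpret aug: Vector_Spaces.linear free_smult scale "augmentation n" by (rule linear_augmentation)
  have "g - (?one c + l) + l \<in> L"
    using l C_L rels_subset_decomposable by (intro free_space.subspace_add[OF L_sub]) auto
  then have m: "g - ?one c \<in> L" by (simp add: algebra_simps)
  have gP: "g \<in> positive_lift"
    using g(1) G by (auto simp: positive_lift_def intro: free_space.span_base)
  have "g - (g - ?one c) \<in> positive_lift"
    using gP m L_P unfolding positive_lift_def by (blast intro: free_space.span_diff)
  then have "augmentation n (?one c) = 0" by (simp add: augmentation_positive)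
  moreover have "augmentation n (?one c) = scale c 1"
    using aug.scale[of c "tuple (replicate n 1)"]
    by (simp only: augmentation_one free_smult_single mult_1_right)
  ultimately have "c = 0" by simp
  with m have "g \<in> free_space.span (H' \<union> C)" by (simp add: L_def)
  moreover have "H' \<union> C \<subseteq> (G \<union> C) - {g}" using g disjoint by (auto simp: H'_def)
  ultimately have "g \<in> free_space.span ((G \<union> C) - {g})"
    using free_space.span_mono by blast
  with g(1) indep show False by (auto simp: free_space.dependent_def)
qed

end
end

section \<open>Brackets in low degree\<close>

context sparse_graded_algebra
begin

lemma low_log_decomposable:
  assumes "f \<in> decomposable_lift n"
  shows "low_log f = 0"
proof -
  interpret L: Vector_Spaces.linear free_smult scale low_log by (rule linear_low_log)
  show ?thesis
    using assms unfolding decomposable_lift_def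
  proof (induction rule: free_space.span_induct_alt)
    case (step c f g)
    then have "low_log f = 0"
      using low_log_mult by (auto simp: low_log_rels sym_lift_def)
    with step(2) show ?case by (simp add: L.add L.scale)
  qed (simp add: L.zero)
qed

lemma bracket_indecomposable:
  assumes b: "b \<noteq> 0" "b \<in> A d" "0 < d" "d < (n + 1) * q"
  shows "indecomposable (sym_invariants scale n) (sym_comp scale A n) (bracket scale n b)"
  unfolding indecomposable_def
proof (intro conjI exI notI)
  let ?R = "sym_invariants scale n"
  interpret R: cring ?R by (rule cring_sym_invariants)
  show comp: "bracket scale n b \<in> sym_comp scale A n d" using b(2) by (rule bracket_in_sym_comp)
  then have "finsum ?R (\<lambda>_. bracket scale n b) {d} = bracket scale n b"
    by (subst R.finsum_insert) (auto simp: sym_comp_def)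
  then show "bracket scale n b \<in> positive_part ?R (sym_comp scale A n)"
    using comp b(3) unfolding positive_part_def
    by (intro CollectI exI[of _ "\<lambda>_. bracket scale n b"] exI[of _ "{d}"]) auto
  assume "bracket scale n b \<in> positive_part ?R (sym_comp scale A n) \<cdot>\<^bsub>?R\<^esub> positive_part ?R (sym_comp scale A n)"
  then obtain f where f: "f \<in> decomposable_lift n" "bracket_lift n b - f \<in> rels n"
    using square_positive_part_subset[of n] unfolding bracket_eq_lift
    by (auto simp: tensor_class_eq_iff)
  then have "f + (bracket_lift n b - f) \<in> decomposable_lift n"
    using rels_subset_decomposable unfolding decomposable_lift_def
    by (intro free_space.span_add) auto
  then have "low_log (bracket_lift n b) = 0" by (simp add: low_log_decomposable)
  with low_log_bracket_lift[OF b(2-4)] b(1) show False by simp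
qed

text \<open>
  Take a basis \<open>C\<close> of the decomposable elements.  Since \<open>low_log\<close> vanishes on \<open>C\<close> and maps the lifted
  brackets back to \<open>B\<close>, both together are independent.  They extend to a basis of the preimage of the
  positive degree part by homogeneous elements; the basis elements outside \<open>C\<close> give the generating
  system.
\<close>

lemma brackets_extend_to_minimal_generating_system:
  assumes indep: "\<not> dependent B" and B: "\<And>b. b \<in> B \<Longrightarrow> \<exists>d. b \<in> A d \<and> 0 < d \<and> d < (n + 1) * q"
  shows "\<exists>G. bracket scale n ` B \<subseteq> G \<and>
    minimal_homogeneous_generating_system (sym_invariants scale n) (tensor_scalars scale n)
      (sym_comp scale A n) G"
proof -
  let ?V = "\<Union>d\<in>{0<..}. sym_lift n d"
  have log_B: "low_log (bracket_lift n b) = b" if "b \<in> B" for b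
    using B[OF that] low_log_bracket_lift by blast
  have lift_B: "bracket_lift n b \<in> ?V" if b: "b \<in> B" for b
  proof -
    obtain d where d: "b \<in> A d" "0 < d" using B[OF b] by auto
    then obtain f where f: "f \<in> sym_lift n d" "bracket_lift n b - f \<in> rels n"
      using bracket_in_sym_comp[OF d(1), of n] by (auto simp: sym_comp_eq bracket_eq_lift tensor_class_eq_iff)
    then have "f + (bracket_lift n b - f) \<in> sym_lift n d"
      using rels_subset_sym_lift by (intro free_space.subspace_add[OF subspace_sym_lift]) auto
    with d show ?thesis by auto
  qed
  obtain C where C: "C \<subseteq> decomposable_lift n" "\<not> free_space.dependent C" "decomposable_lift n \<subseteq> free_space.span C"
    by (rule free_space.maximal_independent_subset)
  have span_C: "free_space.span C = decomposable_lift n"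
    using C free_space.span_minimal[OF C(1)] by (auto simp: decomposable_lift_def)
  have img: "low_log ` bracket_lift n ` B = B" using log_B by (force simp: image_image)
  have inj: "inj_on low_log (bracket_lift n ` B)"
    by (rule inj_onI) (auto simp: log_B)
  have "\<not> free_space.dependent (bracket_lift n ` B \<union> C)"
    by (rule independent_Un_kernel[OF linear_low_log C(2) _ inj])
      (use C(1) low_log_decomposable indep img in auto)
  then obtain M where M: "bracket_lift n ` B \<union> C \<subseteq> M" "M \<subseteq> C \<union> ?V"
      "\<not> free_space.dependent M" "C \<union> ?V \<subseteq> free_space.span M"
    using free_space.maximal_independent_subset_extend[of "bracket_lift n ` B \<union> C" "C \<union> ?V"] lift_B
    by blast
  define G where "G = M - C"
  have G: "G \<subseteq> ?V" "G \<inter> C = {}" "G \<union> C = M" using M by (auto simp: G_def)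
  have "bracket_lift n ` B \<subseteq> G"
  proof
    fix x assume "x \<in> bracket_lift n ` B"
    then obtain b where b: "b \<in> B" "x = bracket_lift n b" by auto
    have "b \<noteq> 0" using b(1) indep dependent_zero by auto
    then have "x \<notin> C" using b log_B[OF b(1)] C(1) low_log_decomposable[of x] by auto
    with b M(1) show "x \<in> G" by (auto simp: G_def)
  qed
  then have "bracket scale n ` B \<subseteq> tensor_class scale n ` G" by (auto simp: bracket_eq_lift)
  moreover have "tensor_class scale n ` G \<subseteq> (\<Union>d. sym_comp scale A n d)"
    using G(1) by (fastforce simp: sym_comp_eq)
  moreover have "generating_system (sym_invariants scale n) (tensor_scalars scale n) (tensor_class scale n ` G)"
    using M(4) by (intro generating_if_spanning[OF G(1) C(1)]) (simp add: G(3))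
  moreover have "\<not> generating_system (sym_invariants scale n) (tensor_scalars scale n) H"
    if "H \<subset> tensor_class scale n ` G" for H
    using M(3) that by (intro minimal_if_independent[OF G(1) span_C G(2)]) (simp_all add: G(3))
  ultimately show ?thesis
    unfolding minimal_homogeneous_generating_system_def
    by (intro exI[of _ "tensor_class scale n ` G"]) simp
qed

end

theorem corollary1:
  fixes scale :: "'k::field \<Rightarrow> 'a::comm_ring_1 \<Rightarrow> 'a"
    and A :: "nat \<Rightarrow> 'a set" and n q :: nat
  assumes "n > 0"
    and "CHAR('k) = 0 \<or> CHAR('k) > n"
    and "connected_graded_algebra scale A"
    and "q > 0" and "A q \<noteq> {0}" and "\<And>d. 0 < d \<Longrightarrow> d < q \<Longrightarrow> A d = {0}"
  shows "(\<forall>b d. b \<noteq> 0 \<and> b \<in> A d \<and> 0 < d \<and> d < (n + 1) * q \<longrightarrow>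
            indecomposable (sym_invariants scale n) (sym_comp scale A n) (bracket scale n b)) \<and>
         (\<forall>B. \<not> module.dependent scale B \<and>
            (\<forall>b\<in>B. \<exists>d. b \<in> A d \<and> 0 < d \<and> d < (n + 1) * q) \<longrightarrow>
            (\<exists>G. bracket scale n ` B \<subseteq> G \<and>
              minimal_homogeneous_generating_system (sym_invariants scale n)
                (tensor_scalars scale n) (sym_comp scale A n) G))"
proof -
  interpret connected_graded_algebra scale A by fact
  interpret sparse_graded_algebra scale A n q
    by unfold_locales (use assms in auto)
  show ?thesis
    using bracket_indecomposable brackets_extend_to_minimal_generating_system by blast
qed

end
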